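(* For every integer $n\ge 1$ and $p=(p_1,\ldots,p_n)\in[0,1]^n$, let $B_1,\ldots,B_n$ be independent random variables with $B_i\sim\operatorname{Bernoulli}(p_i)$, and let $S=\sum_{i=1}^n B_i$. The following statements hold for real $q>0$. (i) If $0<q<1$, then for every $n\ge1$ the function $$(p_1,\ldots,p_n)\longmapsto \sum_{k=0}^n \mathbb{P}(S=k)^q$$ is concave (jointly in the vector $(p_1,\ldots,p_n)$) on $[0,1]^n$ and strictly concave on $(0,1)^n$. Consequently, both the Rényi entropy $H_q(S)$ and the Tsallis entropy $T_q(S)$, as functions of $(p_1,\ldots,p_n)$, are concave on $[0,1]^n$ and strictly concave on $(0,1)^n$. (ii) If $q=1$, then for every $n\ge 1$ the common value $H_1(S)=T_1(S)$ (the Shannon entropy of $S$) is concave as a function of $(p_1,\ldots,p_n)\in[0,1]^n$ (this part is a theorem of Hillion and Johnson). (iii) If $q>1$, then joint concavity fails already for $n=2$. More precisely, there is an affine path $t\mapsto (p_1(t),p_2(t))$, defined for $t$ in a symmetric open interval around $0$ and taking values in $(0,1)^2$, such that along this path both $t\mapsto H_q(S)$ and $t\mapsto T_q(S)$ have strictly positive second derivative at the midpoint $t=0$. Hence, for real $q>0$: $H_q(S)$ is a concave function of $(p_1,\ldots,p_n)$ on $[0,1]^n$ for every $n\ge1$ if and only if $0<q\le 1$; and $T_q(S)$ is a concave function of $(p_1,\ldots,p_n)$ on $[0,1]^n$ for every $n\ge1$ if and only if $0<q\le1$.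
   Context: For a random variable $S$ with values in $\{0,1,\ldots,n\}$ write $f_k=\mathbb{P}(S=k)$. For real $q>0$ with $q\ne 1$, the Rényi and Tsallis entropies of order $q$ are $$H_q(S)=\frac{1}{1-q}\log\sum_{k=0}^n f_k^q,\qquad T_q(S)=\frac{1-\sum_{k=0}^n f_k^q}{q-1},$$ with $\log$ the natural logarithm and $0^q=0$. For $q=1$ both are defined to be their common limit as $q\to1$, the Shannon entropy $H_1(S)=T_1(S)=-\sum_{k=0}^n f_k\log f_k$ (with $0\log 0=0$). "Jointly concave" means concave as a function of the whole vector $(p_1,\ldots,p_n)$. *)

theory Defs
  imports "HOL-Probability.Probability" "HOL-Analysis.Finite_Function_Topology"
begin

text \<open>
  Since the dimension \<open>n\<close> is quantified inside the theorem, vectors in \<open>\<real>^n\<close> are finitely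
  supported maps \<open>nat \<Rightarrow>\<^sub>0 real\<close> whose support lies in \<open>{1..n}\<close>.  This is a real vector space
  with coordinatewise operations, so the library's \<open>concave_on\<close> applies to it.
\<close>

definition unit_cube :: "nat \<Rightarrow> (nat \<Rightarrow>\<^sub>0 real) set" where
  "unit_cube n = {p. Poly_Mapping.keys p \<subseteq> {1..n} \<and> (\<forall>i\<in>{1..n}. Poly_Mapping.lookup p i \<in> {0..1})}"

definition open_unit_cube :: "nat \<Rightarrow> (nat \<Rightarrow>\<^sub>0 real) set" where
  "open_unit_cube n =
     {p. Poly_Mapping.keys p \<subseteq> {1..n} \<and> (\<forall>i\<in>{1..n}. Poly_Mapping.lookup p i \<in> {0<..<1})}"

definition strictly_concave_on :: "'a::real_vector set \<Rightarrow> ('a \<Rightarrow> real) \<Rightarrow> bool" where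
  "strictly_concave_on S f \<longleftrightarrow> convex S \<and>
    (\<forall>x\<in>S. \<forall>y\<in>S. x \<noteq> y \<longrightarrow>
      (\<forall>u>0. \<forall>v>0. u + v = 1 \<longrightarrow> f (u *\<^sub>R x + v *\<^sub>R y) > u * f x + v * f y))"

definition has_second_real_derivative :: "(real \<Rightarrow> real) \<Rightarrow> real \<Rightarrow> real \<Rightarrow> bool" where
  "has_second_real_derivative f D x \<longleftrightarrow>
    (\<exists>f'. (\<forall>\<^sub>F y in nhds x. (f has_real_derivative f' y) (at y)) \<and>
          (f' has_real_derivative D) (at x))"

text \<open>
  The law of \<open>S = B\<^sub>1 + \<dots> + B\<^sub>n\<close>, realised on the canonical product space.  The lemma
  \<open>distr_bernoulli_sum\<close> below shows that every family of independent Bernoulli variables gives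
  this law.  It is meant for \<open>p\<close> in the unit cube; \<open>bernoulli_pmf\<close> clamps other values.
\<close>

definition bernoulli_sum_pmf :: "nat \<Rightarrow> (nat \<Rightarrow>\<^sub>0 real) \<Rightarrow> nat pmf" where
  "bernoulli_sum_pmf n p =
     map_pmf (\<lambda>b. \<Sum>i=1..n. of_bool (b i)) (Pi_pmf {1..n} False (\<lambda>i. bernoulli_pmf (Poly_Mapping.lookup p i)))"

definition power_sum :: "real \<Rightarrow> nat \<Rightarrow> nat pmf \<Rightarrow> real" where
  "power_sum q n P = (\<Sum>k=0..n. pmf P k powr q)"

text \<open>The convention \<open>0 log 0 = 0\<close> holds because multiplication by \<open>0\<close> gives \<open>0\<close>.\<close>

definition shannon_entropy :: "nat \<Rightarrow> nat pmf \<Rightarrow> real" where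
  "shannon_entropy n P = - (\<Sum>k=0..n. pmf P k * ln (pmf P k))"

definition renyi_entropy :: "real \<Rightarrow> nat \<Rightarrow> nat pmf \<Rightarrow> real" where
  "renyi_entropy q n P =
     (if q = 1 then shannon_entropy n P else 1 / (1 - q) * ln (power_sum q n P))"

definition tsallis_entropy :: "real \<Rightarrow> nat \<Rightarrow> nat pmf \<Rightarrow> real" where
  "tsallis_entropy q n P =
     (if q = 1 then shannon_entropy n P else (1 - power_sum q n P) / (q - 1))"

lemma (in prob_space) distr_bernoulli_sum:
  assumes indep: "indep_vars (\<lambda>_. count_space UNIV) B {1..n}"
    and law: "\<And>i. i \<in> {1..n} \<Longrightarrow>
      distr M (count_space UNIV) (B i) = measure_pmf (bernoulli_pmf (Poly_Mapping.lookup p i))"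
  shows "distr M (count_space UNIV) (\<lambda>\<omega>. \<Sum>i=1..n. of_bool (B i \<omega>)) =
    measure_pmf (bernoulli_sum_pmf n p)"
proof (cases "n = 0")
  case True
  then have "bernoulli_sum_pmf n p = return_pmf 0"
    by (simp add: bernoulli_sum_pmf_def)
  with True show ?thesis
    by (simp add: distr_const return_pmf.rep_eq)
next
  case False
  define I where "I = {1..n}"
  have I: "I \<noteq> {}" "finite I" using False by (auto simp: I_def)
  let ?C = "\<lambda>_::nat. count_space (UNIV :: bool set)"
  let ?Q = "Pi_pmf I False (\<lambda>i. bernoulli_pmf (Poly_Mapping.lookup p i))"
  let ?g = "\<lambda>b::nat \<Rightarrow> bool. \<Sum>i\<in>I. of_bool (b i) :: nat"
  have rv: "random_variable (?C i) (B i)" if "i \<in> I" for i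
    using indep that by (auto simp: indep_vars_def I_def)
  have "distr M (Pi\<^sub>M I ?C) (\<lambda>x. \<lambda>i\<in>I. B i x) = Pi\<^sub>M I (\<lambda>i. distr M (?C i) (B i))"
    using indep_vars_iff_distr_eq_PiM'[where M' = ?C and X = B, OF I(1)] rv indep by (simp add: I_def)
  also have "\<dots> = Pi\<^sub>M I (\<lambda>i. distr (measure_pmf ?Q) (?C i) (\<lambda>f. f i))"
  proof (rule PiM_cong[OF refl])
    fix i assume i: "i \<in> I"
    have "distr (measure_pmf ?Q) (?C i) (\<lambda>f. f i) = measure_pmf (map_pmf (\<lambda>f. f i) ?Q)"
      by (simp add: map_pmf_rep_eq)
    also have "\<dots> = measure_pmf (bernoulli_pmf (Poly_Mapping.lookup p i))"
      using I i by (subst Pi_pmf_component) auto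
    finally show "distr M (?C i) (B i) = distr (measure_pmf ?Q) (?C i) (\<lambda>f. f i)"
      using law i by (simp add: I_def)
  qed
  also have "\<dots> = distr (measure_pmf ?Q) (Pi\<^sub>M I ?C) (\<lambda>f. \<lambda>i\<in>I. f i)"
    using prob_space.indep_vars_iff_distr_eq_PiM'
        [where M' = ?C and X = "\<lambda>i f. f i", OF measure_pmf.prob_space_axioms[of ?Q] I(1)]
      indep_vars_Pi_pmf[OF I(2), of False "\<lambda>i. bernoulli_pmf (Poly_Mapping.lookup p i)"] by simp
  finally have eq: "distr M (Pi\<^sub>M I ?C) (\<lambda>x. \<lambda>i\<in>I. B i x) =
    distr (measure_pmf ?Q) (Pi\<^sub>M I ?C) (\<lambda>f. \<lambda>i\<in>I. f i)" .
  have g: "?g \<in> measurable (Pi\<^sub>M I ?C) (count_space UNIV)"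
    by measurable
  have B: "(\<lambda>x. \<lambda>i\<in>I. B i x) \<in> measurable M (Pi\<^sub>M I ?C)"
    using rv by (intro measurable_restrict) auto
  have R: "(\<lambda>f. \<lambda>i\<in>I. f i) \<in> measurable (measure_pmf ?Q) (Pi\<^sub>M I ?C)"
    by (intro measurable_restrict) auto
  have "distr M (count_space UNIV) (?g \<circ> (\<lambda>x. \<lambda>i\<in>I. B i x)) =
    distr (measure_pmf ?Q) (count_space UNIV) (?g \<circ> (\<lambda>f. \<lambda>i\<in>I. f i))"
    using distr_distr[OF g B] distr_distr[OF g R] eq by simp
  moreover have "?g \<circ> (\<lambda>x. \<lambda>i\<in>I. B i x) = (\<lambda>x. \<Sum>i\<in>I. of_bool (B i x))"
    and "?g \<circ> (\<lambda>f. \<lambda>i\<in>I. f i) = ?g"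
    by (auto simp: fun_eq_iff intro!: sum.cong simp del: sum_of_bool_eq)
  ultimately show ?thesis
    by (simp add: bernoulli_sum_pmf_def map_pmf_rep_eq I_def del: sum_of_bool_eq)
qed

lemma power_sum_1:
  assumes "set_pmf P \<subseteq> {0..n}"
  shows "power_sum 1 n P = 1"
  using sum_pmf_eq_1[of "{0..n}" P] assms by (simp add: power_sum_def)

lemma DERIV_power_sum:
  "((\<lambda>q. power_sum q n P) has_real_derivative - shannon_entropy n P) (at 1)"
proof -
  have "((\<lambda>q. pmf P k powr q) has_real_derivative pmf P k * ln (pmf P k)) (at 1)" for k
  proof (cases "pmf P k = 0")
    case False
    then have "pmf P k > 0" by (simp add: pmf_pos)
    then show ?thesis
      by (auto intro!: derivative_eq_intros simp: mult.commute)
  qed simp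
  then show ?thesis
    unfolding power_sum_def shannon_entropy_def minus_minus by (rule DERIV_sum)
qed

text \<open>The Shannon entropy is the common limit of both entropies as the order tends to \<open>1\<close>.\<close>

lemma tendsto_tsallis_entropy:
  assumes "set_pmf P \<subseteq> {0..n}"
  shows "((\<lambda>q. tsallis_entropy q n P) \<longlongrightarrow> shannon_entropy n P) (at 1)"
proof -
  have "((\<lambda>q. - ((power_sum q n P - 1) / (q - 1))) \<longlongrightarrow> - (- shannon_entropy n P)) (at 1)"
    using DERIV_power_sum[of n P] power_sum_1[OF assms]
    by (intro tendsto_minus) (simp add: has_field_derivative_iff)
  moreover have "\<forall>\<^sub>F q in at 1. - ((power_sum q n P - 1) / (q - 1)) = tsallis_entropy q n P"
    by (auto simp: eventually_at_filter tsallis_entropy_def minus_divide_left)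
  ultimately show ?thesis
    by (simp add: tendsto_cong)
qed

lemma tendsto_renyi_entropy:
  assumes "set_pmf P \<subseteq> {0..n}"
  shows "((\<lambda>q. renyi_entropy q n P) \<longlongrightarrow> shannon_entropy n P) (at 1)"
proof -
  have "((\<lambda>q. ln (power_sum q n P)) has_real_derivative - shannon_entropy n P) (at 1)"
    using DERIV_power_sum[of n P] power_sum_1[OF assms]
    by (auto intro!: derivative_eq_intros)
  then have "((\<lambda>q. - (ln (power_sum q n P) / (q - 1))) \<longlongrightarrow> - (- shannon_entropy n P)) (at 1)"
    using power_sum_1[OF assms] by (intro tendsto_minus) (simp add: has_field_derivative_iff)
  moreover have "\<forall>\<^sub>F q in at 1. - (ln (power_sum q n P) / (q - 1)) = renyi_entropy q n P"
    by (auto simp: eventually_at_filter renyi_entropy_def divide_simps algebra_simps)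
  ultimately show ?thesis
    by (simp add: tendsto_cong)
qed

end

theory Submission
  imports Defs
begin

text \<open>
  Along an affine path \<open>p + t v\<close> the masses \<open>f k\<close> of \<open>S\<close> satisfy \<open>f' = \<nabla> g\<close> and \<open>f'' = \<nabla> (\<nabla> h)\<close> with
  \<open>\<nabla> u k = u (k - 1) - u k\<close>, where \<open>g\<close> sums \<open>v i\<close> times the law without \<open>B i\<close> and \<open>h\<close> sums
  \<open>v i * v j\<close> times the law without \<open>B i\<close> and \<open>B j\<close>, over \<open>i \<noteq> j\<close>.  Log-concavity of elementary
  symmetric functions on the positive orthant bounds \<open>h\<close> from above, for \<open>v\<close> of arbitrary signs, by the
  inequality of Hillion and Johnson
  \<open>h k * ((f (k+1))\<^sup>2 - f k * f (k+2)) \<le> 2 * f (k+1) * g k * g (k+1) - f (k+2) * (g k)\<^sup>2 - f k * (g (k+1))\<^sup>2\<close>.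

  Let \<open>a = 1 - q\<close>.  Summation by parts turns the second derivative of the power sum into a sum of
  quadratic forms in \<open>(g k, g (k+1), h k)\<close>, each depending on three consecutive masses.  The total
  coefficient \<open>f k powr (q - 2) + f (k+1) powr (q - 2)\<close> of \<open>(g k)\<^sup>2\<close> must be divided between two of these
  forms; with the right division, after eliminating \<open>h\<close>, each form is positive definite.  In
  logarithmic coordinates the discriminant condition is a hyperbolic inequality that comes down to
  \<open>sinh (a x) / sinh x\<close> being decreasing.
\<close>

subsection \<open>A hyperbolic inequality\<close>

text \<open>The bound on \<open>h\<close> is one-sided. That is enough because \<open>h\<close>
  enters each form multiplied by minus a second difference of \<open>f powr (- a)\<close>, and
  strict log-concavity of the masses with the arithmetic-geometric mean inequality makes this second
  difference positive. Strict log-concavity also makes the factor of \<open>h\<close> in the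
  inequality of Hillion and Johnson positive, so that \<open>h\<close> can be eliminated. The
  arguments \<open>w\<close> and \<open>p\<close> of the elementary symmetric functions are kept
  independent: log-concavity is available for variations of \<open>w\<close> with \<open>p\<close>
  fixed, and these produce \<open>g\<close> and \<open>h\<close>, whereas on the path itself
  \<open>w\<close> falls while \<open>p\<close> rises, which produces the outer
  \<open>\<nabla>\<close>. Strictness is a question of the equality case: if the sum of forms and
  boundary terms is 0, then \<open>g\<close> and \<open>h\<close> vanish, and their totals over all
  indices determine the sum of the squares of the \<open>v i\<close>. Negative powers of the masses
  confine the differentiation to the open cube; the closed cube and the order 1 are reached as
  limits.\<close>

lemma sinh_scaled_less:
  fixes a x :: real
  assumes "0 < a" "a < 1" "0 < x"
  shows "sinh (a * x) < a * sinh x"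
proof -
  let ?f = "\<lambda>x. a * sinh x - sinh (a * x)"
  have "?f 0 < ?f x"
  proof (rule DERIV_pos_imp_increasing_open[OF assms(3)])
    fix y :: real assume y: "0 < y" "y < x"
    have "cosh (a * y) < cosh y"
      using assms y by (intro cosh_real_strict_mono) auto
    then show "\<exists>D. (?f has_real_derivative D) (at y) \<and> D > 0"
      using assms by (intro exI[of _ "a * cosh y - a * cosh (a * y)"] conjI)
        (auto intro!: derivative_eq_intros)
  qed (auto intro!: continuous_intros)
  then show ?thesis by simp
qed

text \<open>The derivative of \<open>sinh (a * t) / sinh t\<close> has the sign of
  \<open>a * cosh (a * t) * sinh t - sinh (a * t) * cosh t\<close>, which is 0 at 0 and has
  derivative \<open>- (1 - a\<^sup>2) * (sinh (a * t) * sinh t)\<close>.\<close>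

lemma sinh_scaled_ratio_antimono:
  fixes a x y :: real
  assumes a: "0 < a" "a < 1" and y: "0 < y" "y \<le> x"
  shows "sinh (a * x) * sinh y \<le> sinh (a * y) * sinh x"
proof -
  have h: "a * cosh (a * t) * sinh t - sinh (a * t) * cosh t \<le> 0" if t: "0 < t" for t
  proof -
    let ?h = "\<lambda>t. a * cosh (a * t) * sinh t - sinh (a * t) * cosh t"
    have "?h t \<le> ?h 0"
    proof (rule DERIV_nonpos_imp_nonincreasing[where f = ?h])
      fix z :: real assume z: "0 \<le> z" "z \<le> t"
      have "(?h has_real_derivative - (1 - a\<^sup>2) * (sinh (a * z) * sinh z)) (at z)"
        by (auto intro!: derivative_eq_intros simp: algebra_simps power2_eq_square)
      moreover have "- (1 - a\<^sup>2) * (sinh (a * z) * sinh z) \<le> 0"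
        using a z by (intro mult_nonpos_nonneg mult_nonneg_nonneg)
          (auto simp: power_le_one_iff abs_square_le_1)
      ultimately show "\<exists>D. (?h has_real_derivative D) (at z) \<and> D \<le> 0" by blast
    qed (use t in auto)
    then show ?thesis by simp
  qed
  let ?r = "\<lambda>t. sinh (a * t) / sinh t"
  have "?r x \<le> ?r y"
  proof (rule DERIV_nonpos_imp_nonincreasing[OF y(2)])
    fix t assume t: "y \<le> t" "t \<le> x"
    then have t0: "sinh t > 0" "t > 0" using y by auto
    have "(?r has_real_derivative (a * cosh (a * t) * sinh t - sinh (a * t) * cosh t) / (sinh t)\<^sup>2) (at t)"
      using t0 by (auto intro!: derivative_eq_intros simp: field_simps power2_eq_square)
    then show "\<exists>D. (?r has_real_derivative D) (at t) \<and> D \<le> 0"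
      using h[OF t0(2)] by (intro exI conjI) (auto intro!: divide_nonpos_nonneg)
  qed
  then show ?thesis using y by (simp add: field_simps)
qed

lemma sinh_cosh_product_identity:
  fixes u v :: real
  shows "cosh (u + v) * cosh (u - v) - 1 = (sinh u)\<^sup>2 + (sinh v)\<^sup>2"
    and "sinh (u + v) * sinh (u - v) = (sinh u)\<^sup>2 - (sinh v)\<^sup>2"
proof -
  have c: "(cosh u)\<^sup>2 = (sinh u)\<^sup>2 + 1" "(cosh v)\<^sup>2 = (sinh v)\<^sup>2 + 1"
    by (simp_all add: cosh_square_eq)
  show "cosh (u + v) * cosh (u - v) - 1 = (sinh u)\<^sup>2 + (sinh v)\<^sup>2"
    unfolding cosh_add cosh_diff using c by algebra
  show "sinh (u + v) * sinh (u - v) = (sinh u)\<^sup>2 - (sinh v)\<^sup>2"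
    unfolding sinh_add sinh_diff using c by algebra
qed

text \<open>In the half sum \<open>u\<close> and the half difference \<open>v\<close> of
  \<open>R\<close> and \<open>Y\<close> the four factors are sums and differences of squares.
  Cross-multiplication leaves the square of \<open>sinh (a * u) * sinh \<bar>v\<bar> \<le> sinh (a *
  \<bar>v\<bar>) * sinh u\<close>, the monotone ratio for
  \<open>\<bar>v\<bar> \<le> u\<close>.\<close>

lemma cosh_product_ratio_antimono:
  fixes a R Y :: real
  assumes a: "0 < a" "a < 1" and "0 < R" "0 < Y"
  shows "(cosh R * cosh Y - 1) * (sinh (a * R) * sinh (a * Y)) \<le>
    (cosh (a * R) * cosh (a * Y) - 1) * (sinh R * sinh Y)"
proof -
  define u where "u = (R + Y) / 2"
  define v where "v = (R - Y) / 2"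
  have uv: "R = u + v" "Y = u - v" "a * R = a * u + a * v" "a * Y = a * u - a * v"
    by (simp_all add: u_def v_def field_simps)
  have le: "sinh (a * u) * sinh \<bar>v\<bar> \<le> sinh (a * \<bar>v\<bar>) * sinh u"
  proof (cases "v = 0")
    case False
    then show ?thesis using assms by (intro sinh_scaled_ratio_antimono) (auto simp: u_def v_def abs_if field_simps)
  qed simp
  have "0 \<le> sinh (a * u)" "0 \<le> sinh \<bar>v\<bar>" using assms by (auto simp: u_def)
  then have "(sinh (a * u) * sinh \<bar>v\<bar>)\<^sup>2 \<le> (sinh (a * \<bar>v\<bar>) * sinh u)\<^sup>2"
    by (intro power_mono le) auto
  moreover have "(sinh \<bar>v\<bar>)\<^sup>2 = (sinh v)\<^sup>2" "(sinh (a * \<bar>v\<bar>))\<^sup>2 = (sinh (a * v))\<^sup>2"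
    by (auto simp: abs_if)
  ultimately have "(sinh (a * u))\<^sup>2 * (sinh v)\<^sup>2 \<le> (sinh (a * v))\<^sup>2 * (sinh u)\<^sup>2"
    by (simp add: power_mult_distrib)
  moreover have "cosh R * cosh Y - 1 = (sinh u)\<^sup>2 + (sinh v)\<^sup>2"
    "cosh (a * R) * cosh (a * Y) - 1 = (sinh (a * u))\<^sup>2 + (sinh (a * v))\<^sup>2"
    "sinh R * sinh Y = (sinh u)\<^sup>2 - (sinh v)\<^sup>2"
    "sinh (a * R) * sinh (a * Y) = (sinh (a * u))\<^sup>2 - (sinh (a * v))\<^sup>2"
    unfolding uv(3,4) unfolding uv(1,2) by (rule sinh_cosh_product_identity)+
  ultimately show ?thesis by (simp only:) (simp add: algebra_simps)
qed

text \<open>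
  \<open>Phi a (u + v) (u - v) - Phi a (u + v) (u + v)\<close> is the quantity \<open>slack a u v\<close> below times a factor
  of known sign, so positivity of \<open>slack\<close> follows from monotonicity of \<open>Phi a R\<close>.
\<close>

definition Phi :: "real \<Rightarrow> real \<Rightarrow> real \<Rightarrow> real" where
  "Phi a R Y =
     (a * exp R * sinh R - exp (a * R) * sinh (a * R)) * (cosh Y * cosh (a * Y))
   + a * sinh R / (1 - a) * (exp R * exp (a * R) * sinh (a * R) + a * sinh R) * cosh ((1 - a) * Y)
   - (a * exp R * exp (a * R) * sinh R - sinh (a * R)) * cosh Y
   + (exp R * exp (a * R) * sinh (a * R) - a * sinh R) * cosh (a * Y)"

text \<open>The derivative of \<open>Phi\<close> in \<open>Y\<close>, regrouped so that the two
  factors compared in \<open>cosh_product_ratio_antimono\<close> appear.\<close>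

definition Phi' :: "real \<Rightarrow> real \<Rightarrow> real \<Rightarrow> real" where
  "Phi' a R Y =
     sinh Y * (cosh (a * R) * cosh (a * Y) - 1) * (a * exp R * exp (a * R) * sinh R - sinh (a * R))
   + sinh Y * cosh (a * Y) * ((a * sinh R)\<^sup>2 - (sinh (a * R))\<^sup>2)
   - a * sinh (a * Y) * (cosh R * cosh Y - 1) * (exp R * exp (a * R) * sinh (a * R) - a * sinh R)"

lemma exp_eq_sinh_plus_cosh: "exp (x::real) = sinh x + cosh x"
  by (simp add: sinh_plus_cosh)

text \<open>\<open>s\<close>, \<open>c\<close>, \<open>r\<close>, \<open>k\<close> stand for the
  hyperbolic sine and cosine of \<open>R\<close> and of \<open>a * R\<close>, and \<open>S\<close>,
  \<open>D\<close>, \<open>T\<close>, \<open>C\<close> for those of \<open>Y\<close> and of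
  \<open>a * Y\<close>. In this form the regrouping is polynomial algebra modulo two Pythagorean
  relations.\<close>

lemma Phi_deriv_identity:
  fixes a s c r k S C T D :: real
  assumes "c\<^sup>2 = s\<^sup>2 + 1" "k\<^sup>2 = r\<^sup>2 + 1"
  shows "(a * (s + c) * s - (r + k) * r) * (S * C + a * D * T)
    + a * s * ((s + c) * (r + k) * r + a * s) * (S * C - D * T)
    - (a * (s + c) * (r + k) * s - r) * S + ((s + c) * (r + k) * r - a * s) * (a * T) =
    S * (k * C - 1) * (a * (s + c) * (r + k) * s - r) + S * C * ((a * s)\<^sup>2 - r\<^sup>2)
    - a * T * (c * D - 1) * ((s + c) * (r + k) * r - a * s)"
  using assms by algebra

lemma has_real_derivative_Phi:
  assumes "a < 1"
  shows "(Phi a R has_real_derivative Phi' a R Y) (at Y)"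
proof -
  have c: "(cosh R)\<^sup>2 = (sinh R)\<^sup>2 + 1" "(cosh (a * R))\<^sup>2 = (sinh (a * R))\<^sup>2 + 1"
    by (simp_all add: cosh_square_eq)
  have S: "sinh ((1 - a) * Y) = sinh Y * cosh (a * Y) - cosh Y * sinh (a * Y)"
    using sinh_diff[of Y "a * Y"] by (simp add: algebra_simps)
  have D: "(Phi a R has_real_derivative
     (a * exp R * sinh R - exp (a * R) * sinh (a * R)) * (sinh Y * cosh (a * Y) + a * cosh Y * sinh (a * Y))
   + a * sinh R * (exp R * exp (a * R) * sinh (a * R) + a * sinh R) * sinh ((1 - a) * Y)
   - (a * exp R * exp (a * R) * sinh R - sinh (a * R)) * sinh Y
   + (exp R * exp (a * R) * sinh (a * R) - a * sinh R) * (a * sinh (a * Y))) (at Y)"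
    unfolding Phi_def[abs_def] using assms
    by (auto intro!: derivative_eq_intros)
  show ?thesis
    unfolding Phi'_def exp_eq_sinh_plus_cosh Phi_deriv_identity[OF c, symmetric]
    using D unfolding S exp_eq_sinh_plus_cosh .
qed

text \<open>After multiplication by \<open>sinh R\<close>, the bound \<open>J\<close> gives the
  first term the factor \<open>c * cosh Y - 1\<close> of the subtracted term. Then the products with
  \<open>E\<close> cancel, and \<open>(a * s)\<^sup>2 - \<sigma>\<^sup>2\<close>, positive by
  \<open>sinh_scaled_less\<close>, factors out of all that is left.\<close>

lemma Phi'_pos:
  assumes a: "0 < a" "a < 1" and R: "0 < R" and Y: "0 < Y"
  shows "Phi' a R Y > 0"
proof -
  define s where "s = sinh R"
  define c where "c = cosh R"
  define \<sigma> where "\<sigma> = sinh (a * R)"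
  define \<kappa> where "\<kappa> = cosh (a * R)"
  define E where "E = exp R * exp (a * R)"
  have pos: "s > 0" "\<sigma> > 0" "sinh Y > 0" "sinh (a * Y) > 0" "cosh (a * Y) > 0" "E > 1"
    using assms by (auto simp: s_def \<sigma>_def E_def exp_add[symmetric] intro: add_pos_pos)
  have sig: "\<sigma> < a * s" using sinh_scaled_less[OF a R] by (simp add: s_def \<sigma>_def)
  have J: "(c * cosh Y - 1) * (\<sigma> * sinh (a * Y)) \<le> (\<kappa> * cosh (a * Y) - 1) * (s * sinh Y)"
    using cosh_product_ratio_antimono[OF a R Y] by (simp add: s_def c_def \<sigma>_def \<kappa>_def)
  have K: "a * E * s - \<sigma> > 0"
  proof -
    have "\<sigma> < 1 * (a * s)" using sig by simp
    also have "\<dots> \<le> E * (a * s)" using pos a by (intro mult_right_mono) auto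
    finally show ?thesis by (simp add: mult_ac)
  qed
  have sq: "(a * s)\<^sup>2 - \<sigma>\<^sup>2 > 0" using sig pos by (simp add: power_strict_mono)
  have c1: "c * cosh Y \<ge> 1" using mult_mono[of 1 c 1 "cosh Y"] by (simp add: c_def cosh_real_ge_1)
  have "s * Phi' a R Y = (\<kappa> * cosh (a * Y) - 1) * (s * sinh Y) * (a * E * s - \<sigma>)
      + s * (sinh Y * cosh (a * Y) * ((a * s)\<^sup>2 - \<sigma>\<^sup>2))
      - s * (a * sinh (a * Y) * (c * cosh Y - 1) * (E * \<sigma> - a * s))"
    unfolding Phi'_def s_def[symmetric] c_def[symmetric] \<sigma>_def[symmetric] \<kappa>_def[symmetric] E_def
    by (simp add: algebra_simps)
  moreover have "(c * cosh Y - 1) * (\<sigma> * sinh (a * Y)) * (a * E * s - \<sigma>)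
      \<le> (\<kappa> * cosh (a * Y) - 1) * (s * sinh Y) * (a * E * s - \<sigma>)"
    using J K by (intro mult_right_mono) auto
  moreover have "(c * cosh Y - 1) * (\<sigma> * sinh (a * Y)) * (a * E * s - \<sigma>)
      + s * (sinh Y * cosh (a * Y) * ((a * s)\<^sup>2 - \<sigma>\<^sup>2))
      - s * (a * sinh (a * Y) * (c * cosh Y - 1) * (E * \<sigma> - a * s)) =
    ((a * s)\<^sup>2 - \<sigma>\<^sup>2) * ((c * cosh Y - 1) * sinh (a * Y) + s * sinh Y * cosh (a * Y))"
    by (simp add: algebra_simps power2_eq_square)
  moreover have "((a * s)\<^sup>2 - \<sigma>\<^sup>2) * ((c * cosh Y - 1) * sinh (a * Y) + s * sinh Y * cosh (a * Y)) > 0"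
    using sq pos c1 by (intro mult_pos_pos add_nonneg_pos mult_nonneg_nonneg) auto
  ultimately have "s * Phi' a R Y > 0" by linarith
  then show ?thesis using pos(1) by (simp add: zero_less_mult_iff)
qed

text \<open>\<open>harm a u\<close> is the reciprocal of \<open>coth (a * u) - coth u\<close>; at \<open>u = 0\<close> the junk value
  \<open>0 / 0 = 0\<close> is the continuous one.\<close>

definition harm :: "real \<Rightarrow> real \<Rightarrow> real" where
  "harm a u = sinh u * sinh (a * u) / sinh ((1 - a) * u)"

text \<open>At \<open>e = exp (2 * u)\<close> and \<open>d = exp (2 * v)\<close> the expression in
  \<open>edge_weight_discriminant_pos\<close> is \<open>4 * (1 - a) / a\<^sup>2\<close> times this
  quantity.\<close>

definition slack :: "real \<Rightarrow> real \<Rightarrow> real \<Rightarrow> real" where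
  "slack a u v = (let s = sinh (u + v); r = sinh (a * (u + v)); g = exp (u + v); k = exp (a * (u + v)) in
     a * s / (1 - a) * (g * k * r + a * s)
     - (a * g * s + k * r) * (harm a u + harm a v) - 2 * (a * g * s - k * r) * (harm a u * harm a v))"

lemma Phi_minus: "Phi a R (- Y) = Phi a R Y"
  by (simp add: Phi_def)

lemma Phi_strict_mono:
  assumes "0 < a" "a < 1" "0 < R" "0 \<le> x" "x < y"
  shows "Phi a R x < Phi a R y"
proof (rule DERIV_pos_imp_increasing_open[OF assms(5)])
  fix t assume "x < t" "t < y"
  then show "\<exists>D. (Phi a R has_real_derivative D) (at t) \<and> D > 0"
    using assms has_real_derivative_Phi[of a R t] Phi'_pos[of a R t] by auto
next
  show "continuous_on {x..y} (Phi a R)"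
    using has_real_derivative_Phi[OF assms(2)]
    by (intro continuous_at_imp_continuous_on ballI) (rule DERIV_isCont)
qed

text \<open>\<open>P\<close> and \<open>Q\<close> stand for \<open>sinh u * sinh v\<close> and
  \<open>sinh (a * u) * sinh (a * v)\<close>, since
  \<open>cosh (u - v) = cosh (u + v) - 2 * P\<close> and likewise with \<open>a\<close>;
  \<open>s\<close>, \<open>c\<close>, \<open>r\<close>, \<open>k\<close> belong to
  \<open>u + v\<close>.\<close>

lemma Phi_diff_identity:
  fixes a s c r k P Q :: real
  assumes "c\<^sup>2 = s\<^sup>2 + 1" "k\<^sup>2 = r\<^sup>2 + 1"
  shows "(a * (s + c) * s - (r + k) * r) * ((c - 2 * P) * (k - 2 * Q) - c * k)
    + (a * (s + c) * (r + k) * s - r) * (2 * P) - ((s + c) * (r + k) * r - a * s) * (2 * Q) =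
    4 * P * Q * (a * (s + c) * s - (r + k) * r) - 2 * (a * (s + c) * s + (r + k) * r) * (s * Q - r * P)"
  using assms by algebra

text \<open>Multiplying \<open>slack\<close> by
  \<open>sinh ((1 - a) * u) * sinh ((1 - a) * v)\<close> clears the denominators of
  \<open>harm\<close>. This factor, \<open>P\<close> and \<open>Q\<close> are half differences of
  hyperbolic cosines at \<open>u + v\<close> and \<open>u - v\<close>, so the result is a difference
  of two values of one function of \<open>Y\<close>.\<close>

lemma Phi_diff:
  assumes "a < 1" "u \<noteq> 0" "v \<noteq> 0"
  shows "Phi a (u + v) (u - v) - Phi a (u + v) (u + v) =
    - 2 * sinh ((1 - a) * u) * sinh ((1 - a) * v) * slack a u v"
proof -
  define s c r k where "s = sinh (u + v)" "c = cosh (u + v)" "r = sinh (a * (u + v))" "k = cosh (a * (u + v))"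
  note skc = this
  define P Q where "P = sinh u * sinh v" "Q = sinh (a * u) * sinh (a * v)"
  note PQ = this
  define zu zv where "zu = sinh ((1 - a) * u)" "zv = sinh ((1 - a) * v)"
  note z = this
  have c: "c\<^sup>2 = s\<^sup>2 + 1" "k\<^sup>2 = r\<^sup>2 + 1"
    by (simp_all add: skc cosh_square_eq)
  have au: "a * (u + v) = a * u + a * v" "a * (u - v) = a * u - a * v" by (simp_all add: algebra_simps)
  have c1: "cosh (u - v) = c - 2 * P" "cosh (a * (u - v)) = k - 2 * Q"
    unfolding skc PQ au cosh_add cosh_diff by simp_all
  have au': "(1 - a) * (u + v) = (1 - a) * u + (1 - a) * v" "(1 - a) * (u - v) = (1 - a) * u - (1 - a) * v"
    by (simp_all add: algebra_simps)
  have cq: "cosh ((1 - a) * (u - v)) = cosh ((1 - a) * (u + v)) - 2 * (zu * zv)"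
    unfolding z au' cosh_add cosh_diff by simp_all
  have zue: "zu = sinh u * cosh (a * u) - cosh u * sinh (a * u)"
    using sinh_diff[of u "a * u"] by (simp add: z algebra_simps)
  have zve: "zv = sinh v * cosh (a * v) - cosh v * sinh (a * v)"
    using sinh_diff[of v "a * v"] by (simp add: z algebra_simps)
  \<comment> \<open>Up to sign, this is the numerator of \<open>harm a u + harm a v\<close> over the
    common denominator \<open>zu * zv\<close>.\<close>
  have key: "s * Q - r * P = - (zu * (sinh v * sinh (a * v)) + zv * (sinh u * sinh (a * u)))"
    unfolding skc(1,3) PQ au zue zve sinh_add by (simp add: algebra_simps)
  have z0: "zu \<noteq> 0" "zv \<noteq> 0" using assms by (auto simp: z)
  have h: "harm a u = sinh u * sinh (a * u) / zu" "harm a v = sinh v * sinh (a * v) / zv"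
    by (simp_all add: harm_def z)
  have h1: "zu * zv * (harm a u + harm a v) = - (s * Q - r * P)"
    unfolding h key using z0 by (simp add: field_simps)
  have h2: "zu * zv * (harm a u * harm a v) = P * Q"
    unfolding h PQ using z0 by (simp add: field_simps)
  have E: "exp (u + v) = s + c" "exp (a * (u + v)) = r + k"
    by (simp_all only: exp_eq_sinh_plus_cosh skc)
  have "Phi a (u + v) (u - v) - Phi a (u + v) (u + v) =
    ((a * (s + c) * s - (r + k) * r) * ((c - 2 * P) * (k - 2 * Q) - c * k)
    + (a * (s + c) * (r + k) * s - r) * (2 * P) - ((s + c) * (r + k) * r - a * s) * (2 * Q))
    - 2 * (zu * zv) * (a * s / (1 - a) * ((s + c) * (r + k) * r + a * s))"
    unfolding Phi_def c1 cq E skc[symmetric] by (simp add: algebra_simps)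
  also have "\<dots> = 4 * (P * Q) * (a * (s + c) * s - (r + k) * r)
     + 2 * (a * (s + c) * s + (r + k) * r) * (- (s * Q - r * P))
     - 2 * (zu * zv) * (a * s / (1 - a) * ((s + c) * (r + k) * r + a * s))"
    unfolding Phi_diff_identity[OF c] by (simp add: algebra_simps)
  also have "\<dots> = - 2 * zu * zv * slack a u v"
    unfolding h1[symmetric] h2[symmetric] slack_def Let_def E skc[symmetric] by (simp add: algebra_simps)
  finally show ?thesis by (simp add: z)
qed

text \<open>The case \<open>Y = R\<close> of \<open>Phi'\<close>, brought to the shape of
  \<open>slack a R 0\<close> with denominators cleared.\<close>

lemma Phi'_diag_identity:
  fixes a s c r k :: real
  assumes "c\<^sup>2 = s\<^sup>2 + 1" "k\<^sup>2 = r\<^sup>2 + 1"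
  shows "s * (k * k - 1) * (a * (s + c) * (r + k) * s - r) + s * k * ((a * s)\<^sup>2 - r\<^sup>2)
    - a * r * (c * c - 1) * ((s + c) * (r + k) * r - a * s) =
    a * s * (s * k - c * r) * ((s + c) * (r + k) * r + a * s) - (1 - a) * (a * (s + c) * s + (r + k) * r) * (s * r)"
  using assms by algebra

lemma slack_commute: "slack a u v = slack a v u"
  by (simp only: slack_def add.commute[of u v] add.commute[of "harm a u"] mult.commute[of "harm a u"])

text \<open>\<open>Phi a (u + v)\<close> is even and strictly increasing on the nonnegative axis, so
  \<open>\<bar>u - v\<bar>\<close> has to be compared with \<open>u + v\<close>. It is smaller if
  \<open>u\<close> and \<open>v\<close> are both positive and larger if their signs differ; the
  factor in \<open>Phi_diff\<close> changes sign in step with this.\<close>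

lemma slack_pos:
  assumes a: "0 < a" "a < 1" and uv: "0 < u + v"
  shows "slack a u v > 0"
proof -
  \<comment> \<open>At \<open>v = 0\<close> the identity \<open>Phi_diff\<close> would read 0 = 0.
    Its first-order term in \<open>v\<close> links \<open>slack a u 0\<close> with
    \<open>Phi' a u u\<close>, and this link is verified directly.\<close>
  have zero: "slack a u 0 > 0" if u: "0 < u" for u
  proof -
    define s c r k where "s = sinh u" "c = cosh u" "r = sinh (a * u)" "k = cosh (a * u)"
    note skc = this
    have c: "c\<^sup>2 = s\<^sup>2 + 1" "k\<^sup>2 = r\<^sup>2 + 1"
      by (simp_all add: skc cosh_square_eq)
    have E: "exp u = s + c" "exp (a * u) = r + k"
      by (simp_all only: exp_eq_sinh_plus_cosh skc)
    define z where "z = sinh ((1 - a) * u)"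
    have z: "z = s * k - c * r"
      using sinh_diff[of u "a * u"] by (simp add: z_def skc algebra_simps)
    have "z > 0" using a u by (simp add: z_def)
    have "Phi' a u u = a * s * z * ((s + c) * (r + k) * r + a * s) - (1 - a) * (a * (s + c) * s + (r + k) * r) * (s * r)"
      unfolding Phi'_def E skc[symmetric] z by (rule Phi'_diag_identity[OF c])
    also have "\<dots> = (1 - a) * z * (a * s / (1 - a) * ((s + c) * (r + k) * r + a * s)
        - (a * (s + c) * s + (r + k) * r) * (s * r / z))"
      using \<open>z > 0\<close> a by (simp add: right_diff_distrib)
    also have "\<dots> = (1 - a) * z * slack a u 0"
      unfolding slack_def Let_def harm_def add_0_right E skc[symmetric] z_def[symmetric] by simp
    finally have "(1 - a) * z * slack a u 0 > 0" using Phi'_pos[OF a u u] by simp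
    moreover have "(1 - a) * z > 0" using a \<open>z > 0\<close> by simp
    ultimately show ?thesis by (metis zero_less_mult_pos)
  qed
  show ?thesis
  proof (cases "u = 0 \<or> v = 0")
    case True
    then show ?thesis using zero[of u] zero[of v] uv slack_commute[of a 0 v] by auto
  next
    case False
    define Y where "Y = \<bar>u - v\<bar>"
    have "Phi a (u + v) (u - v) = Phi a (u + v) Y"
      using Phi_minus[of a "u + v" "u - v"] by (simp add: Y_def abs_if)
    define m where "m = sinh ((1 - a) * u) * sinh ((1 - a) * v)"
    have eq: "Phi a (u + v) Y - Phi a (u + v) (u + v) = - 2 * (m * slack a u v)"
      unfolding \<open>Phi a (u + v) (u - v) = Phi a (u + v) Y\<close>[symmetric] m_def using Phi_diff[of a u v] False a by simp
    show ?thesis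
    proof (cases "0 < u \<and> 0 < v")
      case True
      then have "Phi a (u + v) Y < Phi a (u + v) (u + v)"
        by (intro Phi_strict_mono a uv) (auto simp: Y_def)
      then have "0 < m * slack a u v" using eq by linarith
      moreover have "0 < m" using True a by (simp add: m_def)
      ultimately show ?thesis by (rule zero_less_mult_pos)
    next
      case neg: False
      then have "0 < u \<and> v < 0 \<or> u < 0 \<and> 0 < v" using False uv by linarith
      then have "u + v < Y" "m < 0" using a by (auto simp: Y_def m_def mult_less_0_iff)
      then have "Phi a (u + v) (u + v) < Phi a (u + v) Y"
        using uv by (intro Phi_strict_mono a) auto
      then have "m * slack a u v < 0" using eq by linarith
      then show ?thesis using \<open>m < 0\<close> by (simp add: mult_less_0_iff)
    qed
  qed
qed

text \<open>
  This choice makes the discriminant of the local form vanish to second order as \<open>e * d\<close> tends to \<open>1\<close>,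
  that is, at geometric triples of masses; weights given by simpler means of the two masses do not
  work.  At \<open>e = 1\<close> the junk value \<open>0 / 0 = 0\<close> gives the continuous value \<open>1\<close>.
\<close>

definition edge_weight :: "real \<Rightarrow> real \<Rightarrow> real" where
  "edge_weight a e = e * (e powr a - (1 - a) * (e powr a - 1)\<^sup>2 / (a * (e - e powr a)))"

text \<open>\<open>b\<close>, \<open>c\<close>, \<open>F\<close> stand for \<open>e powr a\<close>,
  \<open>d powr a\<close>, \<open>1 / (e * d)\<close>, and \<open>r1\<close>, \<open>r2\<close> for
  twice \<open>harm\<close> at the two logarithmic coordinates. The left side is
  \<open>a\<^sup>2\<close> times the discriminant expression after insertion of
  \<open>edge_weight_exp\<close>; the right side has the terms of \<open>slack\<close>.\<close>

lemma slack_identity: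
  fixes a b c d e r1 r2 F :: real
  assumes r: "r1 * (e - b) = (b - 1) * (e - 1)" "r2 * (d - c) = (c - 1) * (d - 1)" and F: "e * d * F = 1"
  shows "(e * d - 1) * (a + b - 1 - (1 - a) * r1) * (a + c - 1 - (1 - a) * r2) - a\<^sup>2 * (1 - F)
      - (b + c - 2) * (1 - a) * (r1 + r2) =
    a * ((e * d - 1) * (b * c - 1) + a * ((e * d - 1)\<^sup>2 * F))
      - (1 - a) * (a * (e * d - 1) + b * c - 1) * (r1 + r2)
      - (1 - a) * (a * (e * d - 1) - (b * c - 1)) * r1 * r2" (is "?L = ?R")
proof -
  have "(e * d - 1)\<^sup>2 * F = (e * d - 1) - (1 - F)"
    using F by algebra
  then have "?L - ?R = (e * d - 1) * (a + b - 1 - (1 - a) * r1) * (a + c - 1 - (1 - a) * r2)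
      - (b + c - 2) * (1 - a) * (r1 + r2) - a * ((e * d - 1) * (b * c - 1) + a * (e * d - 1))
      + (1 - a) * (a * (e * d - 1) + b * c - 1) * (r1 + r2)
      + (1 - a) * (a * (e * d - 1) - (b * c - 1)) * r1 * r2"
    by algebra
  also have "\<dots> = (1 - a) * (r1 * e * (r2 * (d - c) - (c - 1) * (d - 1))
      + (c * r2 - (c - 1)) * (r1 * (e - b) - (b - 1) * (e - 1))
      - (b - 1) * e * (r2 * (d - c) - (c - 1) * (d - 1)))"
    by algebra
  also have "\<dots> = 0" using r by simp
  finally show ?thesis by simp
qed

section \<open>Translation between mass ratios and hyperbolic coordinates\<close>

lemma exp_diff_eq_sinh: "exp x - exp y = 2 * exp ((x + y) / 2) * sinh ((x - y) / 2)" for x y :: real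
proof -
  have "exp ((x + y) / 2) * exp ((x - y) / 2) = exp x" "exp ((x + y) / 2) * exp (- ((x - y) / 2)) = exp y"
    by (simp_all add: exp_add[symmetric] field_simps)
  then show ?thesis by (simp add: sinh_field_def algebra_simps)
qed

lemma exp_minus_one_eq_sinh: "exp (2 * x) - 1 = 2 * exp x * sinh x" for x :: real
  using exp_diff_eq_sinh[of "2 * x" 0] by simp

text \<open>With \<open>e = exp (2 * u)\<close> and \<open>b = e powr a\<close> this is
  \<open>2 * harm a u = (b - 1) * (e - 1) / (e - b)\<close>, in a product form that includes
  \<open>u = 0\<close>.\<close>

lemma harm_eq:
  assumes "a < 1"
  shows "2 * harm a u * (exp (2 * u) - exp (2 * u) powr a) = (exp (2 * u) powr a - 1) * (exp (2 * u) - 1)"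
proof (cases "u = 0")
  case False
  have p: "exp (2 * u) powr a = exp (2 * (a * u))" by (simp add: powr_def mult_ac)
  have "(2 * u + 2 * (a * u)) / 2 = u + a * u" "(2 * u - 2 * (a * u)) / 2 = (1 - a) * u"
    by (simp_all add: field_simps)
  then have "exp (2 * u) - exp (2 * (a * u)) = 2 * (exp u * exp (a * u)) * sinh ((1 - a) * u)"
    using exp_diff_eq_sinh[of "2 * u" "2 * (a * u)"] by (simp only: exp_add)
  moreover have "sinh ((1 - a) * u) \<noteq> 0" using assms False by auto
  ultimately show ?thesis
    unfolding p exp_minus_one_eq_sinh harm_def by (simp add: field_simps)
qed simp

text \<open>The square in \<open>edge_weight\<close> splits as
  \<open>(b - 1)\<^sup>2 = (b - 1) * (e - 1) - (b - 1) * (e - b)\<close>. The first part yields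
  \<open>harm\<close>; in the second the denominator \<open>e - b\<close> cancels.\<close>

lemma edge_weight_exp:
  assumes "0 < a" "a < 1"
  shows "a * (edge_weight a (exp (2 * u)) / exp (2 * u)) =
    a + exp (2 * u) powr a - 1 - (1 - a) * (2 * harm a u)"
proof (cases "u = 0")
  case False
  define e b h where "e = exp (2 * u)" "b = exp (2 * u) powr a" "h = harm a u"
  note ebh = this
  have "b \<noteq> e" using assms False by (simp add: ebh powr_def)
  moreover have "2 * h * (e - b) = (b - 1) * (e - 1)"
    using harm_eq[OF assms(2), of u] by (simp add: ebh)
  then have "2 * h = (b - 1) * (e - 1) / (e - b)" using \<open>b \<noteq> e\<close> by (simp add: field_simps)
  moreover have "edge_weight a e / e = b - (1 - a) * (b - 1)\<^sup>2 / (a * (e - b))"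
    by (simp add: edge_weight_def ebh)
  moreover have "a * (b - (1 - a) * (b - 1)\<^sup>2 / (a * (e - b))) = a * b - (1 - a) * (b - 1)\<^sup>2 / (e - b)"
    unfolding right_diff_distrib[of a b] using assms by simp
  moreover have "a * b - (1 - a) * (b - 1)\<^sup>2 / (e - b) = a + b - 1 - (1 - a) * ((b - 1) * (e - 1) / (e - b))"
    using \<open>b \<noteq> e\<close> by (simp add: field_simps power2_eq_square)
  ultimately show ?thesis by (simp add: ebh)
qed (use assms in \<open>simp add: edge_weight_def harm_def\<close>)

text \<open>The determinant condition for \<open>local_energy\<close>, where \<open>e\<close> and
  \<open>d\<close> are the ratios of the middle mass to its neighbours, \<open>1 < e * d\<close> is
  strict log-concavity, and \<open>T\<close> is a rescaled second difference of the powers with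
  exponent \<open>- a\<close>.\<close>

lemma edge_weight_discriminant_pos:
  fixes a e d :: real
  assumes a: "0 < a" "a < 1" and ed: "0 < e" "0 < d" "1 < e * d"
  defines "T \<equiv> (e powr a + d powr a - 2) / a"
  shows "(edge_weight a e * edge_weight a d - 1) * (1 - 1 / (e * d))
    + T * (edge_weight a e / e + edge_weight a d / d - 2 - T) > 0"
proof -
  define u v where "u = ln e / 2" "v = ln d / 2"
  have e: "e = exp (2 * u)" and d: "d = exp (2 * v)" using ed by (simp_all add: u_v_def)
  have "0 < ln (e * d)" using ed by simp
  then have uv: "0 < u + v" using ed by (simp add: u_v_def ln_mult field_simps)
  define b c where "b = e powr a" "c = d powr a"
  note bc = this
  define A1 A2 where "A1 = edge_weight a e / e" "A2 = edge_weight a d / d"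
  note A = this
  define r1 r2 where "r1 = 2 * harm a u" "r2 = 2 * harm a v"
  note r = this
  define F where "F = 1 / (e * d)"
  have F: "e * d * F = 1" using ed by (simp add: F_def)
  have A1: "a * A1 = a + b - 1 - (1 - a) * r1" and A2: "a * A2 = a + c - 1 - (1 - a) * r2"
    using edge_weight_exp[OF a] by (simp_all add: A bc r e d)
  have r1: "r1 * (e - b) = (b - 1) * (e - 1)" and r2: "r2 * (d - c) = (c - 1) * (d - 1)"
    using harm_eq[OF a(2)] by (simp_all add: bc r e d)
  have aT: "a * T = b + c - 2" using a by (simp add: T_def bc)
  have W: "edge_weight a e * edge_weight a d = e * d * A1 * A2" using ed by (simp add: A)
  define s \<rho> g k where "s = sinh (u + v)" "\<rho> = sinh (a * (u + v))" "g = exp (u + v)" "k = exp (a * (u + v))"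
  note sk = this
  have "e * d = exp (2 * (u + v))" "b * c = exp (2 * (a * (u + v)))"
    by (simp_all add: bc e d powr_def exp_add[symmetric] algebra_simps)
  then have gs: "e * d - 1 = 2 * g * s" and kr: "b * c - 1 = 2 * k * \<rho>" and gg: "g\<^sup>2 = e * d"
    by (simp_all only: exp_minus_one_eq_sinh sk exp_double[symmetric])
  have ss: "(e * d - 1)\<^sup>2 * F = 4 * s\<^sup>2"
    unfolding gs using F gg by algebra
  have "a\<^sup>2 * ((e * d * A1 * A2 - 1) * (1 - F) + T * (A1 + A2 - 2 - T)) =
    (e * d - 1) * (a * A1) * (a * A2) - a\<^sup>2 * (1 - F) + (a * T) * (a * A1 + a * A2 - 2 * a - a * T)"
    using F by algebra
  also have "\<dots> = (e * d - 1) * (a + b - 1 - (1 - a) * r1) * (a + c - 1 - (1 - a) * r2) - a\<^sup>2 * (1 - F)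
      - (b + c - 2) * (1 - a) * (r1 + r2)"
    unfolding A1 A2 aT by algebra
  also have "\<dots> = a * ((2 * g * s) * (2 * k * \<rho>) + a * (4 * s\<^sup>2))
      - (1 - a) * (a * (2 * g * s) + 2 * k * \<rho>) * (r1 + r2)
      - (1 - a) * (a * (2 * g * s) - 2 * k * \<rho>) * r1 * r2"
    unfolding slack_identity[OF r1 r2 F] ss using gs kr by algebra
  also have "\<dots> = 4 * ((1 - a) * slack a u v)"
  proof -
    have "(1 - a) * slack a u v = (1 - a) * (a * s / (1 - a) * (g * k * \<rho> + a * s))
      - (1 - a) * ((a * g * s + k * \<rho>) * (harm a u + harm a v) + 2 * (a * g * s - k * \<rho>) * (harm a u * harm a v))"
      unfolding slack_def Let_def sk[symmetric] right_diff_distrib[of "1 - a"] distrib_left[of "1 - a"] by simp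
    also have "(1 - a) * (a * s / (1 - a) * (g * k * \<rho> + a * s)) = a * s * (g * k * \<rho> + a * s)"
      using a by simp
    finally show ?thesis unfolding r by algebra
  qed
  also have "\<dots> > 0" using slack_pos[OF a uv] a by simp
  finally show ?thesis using a by (simp add: W A[symmetric] F_def[symmetric] zero_less_mult_iff)
qed

subsection \<open>The local quadratic form\<close>

lemma powr_Bernoulli_le:
  fixes a e :: real
  assumes "0 < a" "a < 1" "0 < e"
  shows "e powr a \<le> 1 - a + a * e"
  using Youngs_inequality_0[of a "1 - a" e 1] assms by simp

text \<open>For \<open>e < 1\<close> the denominator \<open>e - b\<close> is negative and the
  correction only adds. For \<open>1 < e\<close> Bernoulli's inequality gives
  \<open>(1 - a) * (b - 1) \<le> a * (e - b)\<close>, so at most \<open>b - 1\<close> is subtracted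
  from \<open>b\<close>.\<close>

lemma edge_weight_pos:
  assumes a: "0 < a" "a < 1" and e: "0 < e"
  shows "edge_weight a e > 0"
proof -
  define b where "b = e powr a"
  have b: "b > 0" using e by (simp add: b_def)
  have "b - (1 - a) * (b - 1)\<^sup>2 / (a * (e - b)) > 0"
  proof (cases e "1::real" rule: linorder_cases)
    case less
    then have "e < b" using powr_less_mono'[of e a 1] a e by (simp add: b_def)
    then have "(1 - a) * (b - 1)\<^sup>2 / (a * (e - b)) \<le> 0"
      using a by (intro divide_nonneg_nonpos mult_nonneg_nonneg mult_nonneg_nonpos) auto
    then show ?thesis using b by linarith
  next
    case greater
    then have eb: "b < e" "1 < b" using powr_less_mono[of a 1 e] a e by (simp_all add: b_def)
    have "(1 - a) * (b - 1) \<le> a * (e - b)"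
      using powr_Bernoulli_le[OF a e] by (simp add: b_def algebra_simps)
    then have "(1 - a) * (b - 1) * (b - 1) \<le> a * (e - b) * (b - 1)"
      using eb by (intro mult_right_mono) auto
    also have "\<dots> < a * (e - b) * b"
      using eb a by (intro mult_strict_left_mono) auto
    finally show ?thesis using a eb by (simp add: field_simps power2_eq_square)
  qed (simp add: b_def)
  then show ?thesis using e by (simp add: edge_weight_def b_def)
qed

text \<open>This makes the division of the coefficients exact: for \<open>e = f (k+1) / f k\<close>,
  multiplication by \<open>f k powr (- 1 - a)\<close> shows that the two shares add up to
  \<open>f k powr (- 1 - a) + f (k+1) powr (- 1 - a)\<close>. The correction terms of the two shares
  are opposite.\<close>

lemma edge_weight_reflect:
  assumes a: "0 < a" "a < 1" and e: "0 < e"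
  shows "e powr (- 1 - a) * edge_weight a e + edge_weight a (1 / e) = 1 + e powr (- 1 - a)"
proof (cases "e = 1")
  case False
  define b where "b = e powr a"
  have b: "b > 0" using e by (simp add: b_def)
  have "b \<noteq> e"
    using powr_inj[of e a 1] a e False by (simp add: b_def)
  have p: "e powr (- 1 - a) = 1 / (e * b)"
    using e by (simp add: b_def powr_diff powr_minus field_simps)
  have r: "(1 / e) powr a = 1 / b"
    using e by (simp add: b_def powr_divide)
  have 1: "1 / (e * b) * edge_weight a e = 1 - (1 - a) * (b - 1)\<^sup>2 / (a * (e - b) * b)"
    using b e a \<open>b \<noteq> e\<close> by (simp add: edge_weight_def b_def[symmetric] field_simps)
  have "1 / e - 1 / b = - ((e - b) / (e * b))" using b e by (simp add: field_simps)
  moreover have "(1 / b - 1)\<^sup>2 = (b - 1)\<^sup>2 / b\<^sup>2"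
    using b by (simp add: power_divide[symmetric] diff_divide_distrib power2_commute)
  ultimately have "edge_weight a (1 / e) = 1 / (e * b) + (1 - a) * (b - 1)\<^sup>2 / (a * (e - b) * b)"
    using b e a \<open>b \<noteq> e\<close> by (simp add: edge_weight_def r power2_eq_square) (simp add: field_simps)
  with 1 p show ?thesis by simp
qed (simp add: edge_weight_def)

lemma positive_definite_quadratic:
  fixes A B C x y :: real
  assumes "0 < A" "C\<^sup>2 < A * B"
  shows "0 \<le> A * x\<^sup>2 + B * y\<^sup>2 - 2 * C * x * y"
    and "A * x\<^sup>2 + B * y\<^sup>2 - 2 * C * x * y = 0 \<Longrightarrow> x = 0 \<and> y = 0"
proof -
  have eq: "A * (A * x\<^sup>2 + B * y\<^sup>2 - 2 * C * x * y) = (A * x - C * y)\<^sup>2 + (A * B - C\<^sup>2) * y\<^sup>2"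
    by (simp add: power2_eq_square algebra_simps)
  have "0 \<le> (A * x - C * y)\<^sup>2 + (A * B - C\<^sup>2) * y\<^sup>2" using assms by simp
  then show "0 \<le> A * x\<^sup>2 + B * y\<^sup>2 - 2 * C * x * y"
    using assms(1) unfolding eq[symmetric] by (simp add: zero_le_mult_iff)
  assume "A * x\<^sup>2 + B * y\<^sup>2 - 2 * C * x * y = 0"
  with eq have "(A * x - C * y)\<^sup>2 + (A * B - C\<^sup>2) * y\<^sup>2 = 0" by simp
  moreover have "0 \<le> (A * B - C\<^sup>2) * y\<^sup>2" using assms by simp
  ultimately have "(A * B - C\<^sup>2) * y\<^sup>2 = 0" "(A * x - C * y)\<^sup>2 = 0"
    using zero_le_power2[of "A * x - C * y"] by linarith+
  then show "x = 0 \<and> y = 0" using assms by auto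
qed

text \<open>\<open>x\<close>, \<open>y\<close>, \<open>z\<close> are three consecutive masses, and
  only the ratios \<open>e\<close> and \<open>d\<close> matter up to scaling. Multiplying by
  \<open>D > 0\<close> and inserting the upper bound on \<open>h\<close>, whose coefficient is
  negative, leaves a binary form in \<open>g\<close> and \<open>g'\<close> with determinant governed
  by \<open>edge_weight_discriminant_pos\<close>.\<close>

lemma local_energy:
  fixes a x y z g g' h :: real
  assumes a: "0 < a" "a < 1" and pos: "0 < x" "0 < y" "0 < z" and lc: "x * z < y\<^sup>2"
    and key: "h * (y\<^sup>2 - x * z) \<le> 2 * y * g * g' - z * g\<^sup>2 - x * g'\<^sup>2"
  defines "\<tau> \<equiv> y powr (- 1 - a)"
  defines "Q \<equiv> \<tau> * edge_weight a (y / x) * g\<^sup>2 + \<tau> * edge_weight a (y / z) * g'\<^sup>2 - 2 * \<tau> * g * g'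
    - h * (x powr (- a) - 2 * y powr (- a) + z powr (- a)) / a"
  shows "0 \<le> Q" and "Q = 0 \<Longrightarrow> g = 0 \<and> g' = 0 \<and> h = 0"
proof -
  define e d where "e = y / x" "d = y / z"
  note ed = this
  define T where "T = (e powr a + d powr a - 2) / a"
  define D where "D = 1 - 1 / (e * d)"
  define A B where "A = edge_weight a e" "B = edge_weight a d"
  note AB = this
  have ed0: "0 < e" "0 < d" "1 < e * d"
    using pos lc by (simp_all add: ed field_simps power2_eq_square)
  have D: "D > 0" using ed0 by (simp add: D_def)
  have A: "A > 0" "B > 0" using edge_weight_pos[OF a] ed0 by (simp_all add: AB)
  have T: "T > 0"
  proof -
    define p q where "p = e powr (a / 2)" "q = d powr (a / 2)"
    have sq: "e powr a = p\<^sup>2" "d powr a = q\<^sup>2"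
      using ed0 by (simp_all add: p_q_def power2_eq_square powr_add[symmetric])
    have "1 < (e * d) powr (a / 2)" using ed0 a by simp
    then have "1 < p * q" using ed0 by (simp add: p_q_def powr_mult)
    moreover have "0 \<le> (p - q)\<^sup>2" by simp
    ultimately have "p\<^sup>2 + q\<^sup>2 > 2" by (simp add: power2_diff)
    then show ?thesis using a by (simp add: T_def sq)
  qed
  have x: "x = y / e" and z: "z = y / d" using pos by (simp_all add: ed)
  have E: "(x powr (- a) - 2 * y powr (- a) + z powr (- a)) / a = \<tau> * (y * T)"
    using pos ed0 a unfolding x z T_def \<tau>_def
    by (simp add: powr_diff powr_minus powr_divide field_simps)
  have Q: "Q = \<tau> * (A * g\<^sup>2 + B * g'\<^sup>2 - 2 * g * g' - h * y * T)"
    unfolding Q_def ed[symmetric] AB[symmetric] times_divide_eq_right[symmetric] E by (simp add: algebra_simps)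
  have \<tau>: "\<tau> > 0" using pos by (simp add: \<tau>_def)
  have yD: "y\<^sup>2 - x * z = y * (y * D)"
    using ed0 by (simp add: x z D_def power2_eq_square field_simps)
  have "2 * y * g * g' - z * g\<^sup>2 - x * g'\<^sup>2 = y * (2 * g * g' - g\<^sup>2 / d - g'\<^sup>2 / e)"
    unfolding x z by (simp add: algebra_simps)
  with key have "y * (h * y * D) \<le> y * (2 * g * g' - g\<^sup>2 / d - g'\<^sup>2 / e)"
    unfolding yD by (simp add: mult_ac)
  then have "h * y * D \<le> 2 * g * g' - g\<^sup>2 / d - g'\<^sup>2 / e"
    using pos by simp
  then have hT: "h * y * D * T \<le> (2 * g * g' - g\<^sup>2 / d - g'\<^sup>2 / e) * T"
    using T by (intro mult_right_mono) auto
  define P where "P = (A * D + T / d) * g\<^sup>2 + (B * D + T / e) * g'\<^sup>2 - 2 * (D + T) * g * g'"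
  have PQ: "P \<le> (A * g\<^sup>2 + B * g'\<^sup>2 - 2 * g * g' - h * y * T) * D"
    using hT unfolding P_def by (simp add: algebra_simps)
  have det: "(D + T)\<^sup>2 < (A * D + T / d) * (B * D + T / e)"
  proof -
    have "(A * D + T / d) * (B * D + T / e) = A * B * D\<^sup>2 + D * T * (A / e + B / d) + T\<^sup>2 * (1 / (e * d))"
      using ed0 by (simp add: field_simps power2_eq_square)
    \<comment> \<open>This cancels the pure \<open>T\<^sup>2\<close> against that of
      \<open>(D + T)\<^sup>2\<close> up to a multiple of \<open>D\<close>, so \<open>D\<close>
      factors out of the determinant.\<close>
    also have "1 / (e * d) = 1 - D" by (simp add: D_def)
    finally have "(A * D + T / d) * (B * D + T / e) - (D + T)\<^sup>2 =
        D * ((A * B - 1) * D + T * (A / e + B / d - 2 - T))"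
      by (simp add: algebra_simps power2_eq_square)
    moreover have "(A * B - 1) * D + T * (A / e + B / d - 2 - T) > 0"
      using edge_weight_discriminant_pos[OF a ed0] by (simp add: AB D_def T_def)
    ultimately show ?thesis using mult_pos_pos[OF D] by (metis diff_gt_0_iff_gt)
  qed
  have diag: "0 < A * D + T / d" using A D T ed0 by (simp add: add_pos_pos)
  have P0: "P \<ge> 0" and P1: "P = 0 \<Longrightarrow> g = 0 \<and> g' = 0"
    using positive_definite_quadratic[OF diag det, of g g'] by (simp_all add: P_def)
  have "0 \<le> (A * g\<^sup>2 + B * g'\<^sup>2 - 2 * g * g' - h * y * T) * D" using P0 PQ by linarith
  then show "0 \<le> Q" using D \<tau> unfolding Q by (simp add: zero_le_mult_iff)
  assume "Q = 0"
  then have Q0: "A * g\<^sup>2 + B * g'\<^sup>2 - 2 * g * g' - h * y * T = 0" using \<tau> by (simp add: Q)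
  with PQ P0 P1 have "g = 0 \<and> g' = 0" by simp
  with Q0 pos T show "g = 0 \<and> g' = 0 \<and> h = 0" by simp
qed

subsection \<open>Weighted elementary symmetric functions\<close>

text \<open>
  \<open>wesym1\<close> and \<open>wesym2\<close> are the first and second derivatives of \<open>wesym\<close> in \<open>w\<close> along \<open>v\<close>
  (\<open>wesym2\<close> as a bilinear form).  With \<open>w = 1 - p\<close> they are the \<open>f\<close>, \<open>g\<close>, \<open>h\<close> of the introduction.
\<close>

definition wesym :: "'a set \<Rightarrow> ('a \<Rightarrow> real) \<Rightarrow> ('a \<Rightarrow> real) \<Rightarrow> nat \<Rightarrow> real" where
  "wesym I w p k = coeff (\<Prod>i\<in>I. [:w i, p i:]) k"

definition wesym1 :: "'a set \<Rightarrow> ('a \<Rightarrow> real) \<Rightarrow> ('a \<Rightarrow> real) \<Rightarrow> ('a \<Rightarrow> real) \<Rightarrow> nat \<Rightarrow> real" where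
  "wesym1 I w p v k = (\<Sum>i\<in>I. v i * wesym (I - {i}) w p k)"

definition wesym2 :: "'a set \<Rightarrow> ('a \<Rightarrow> real) \<Rightarrow> ('a \<Rightarrow> real) \<Rightarrow> ('a \<Rightarrow> real) \<Rightarrow> ('a \<Rightarrow> real) \<Rightarrow> nat \<Rightarrow> real" where
  "wesym2 I w p v v' k = (\<Sum>i\<in>I. v i * wesym1 (I - {i}) w p v' k)"

lemma wesym_remove:
  assumes "finite I" "i \<in> I"
  shows "wesym I w p k =
    w i * wesym (I - {i}) w p k + (if k = 0 then 0 else p i * wesym (I - {i}) w p (k - 1))"
  using assms by (cases k) (simp_all add: wesym_def prod.remove[of I i])

lemma wesym_insert:
  assumes "finite I" "i \<notin> I"
  shows "wesym (insert i I) w p k =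
    w i * wesym I w p k + (if k = 0 then 0 else p i * wesym I w p (k - 1))"
  using assms wesym_remove[of "insert i I" i w p k] by simp

lemma wesym_eq_0:
  assumes "finite I" "card I < k"
  shows "wesym I w p k = 0"
  using assms
proof (induction I arbitrary: k rule: finite_induct)
  case (insert i I)
  then show ?case by (auto simp: wesym_insert)
qed (simp add: wesym_def)

lemma wesym_card:
  assumes "finite I"
  shows "wesym I w p (card I) = (\<Prod>i\<in>I. p i)"
  using assms
proof (induction I rule: finite_induct)
  case (insert i I)
  then show ?case by (simp add: wesym_insert wesym_eq_0)
qed (simp add: wesym_def)

lemma wesym_nonneg:
  assumes "finite I" "\<And>i. i \<in> I \<Longrightarrow> 0 \<le> w i \<and> 0 \<le> p i"
  shows "0 \<le> wesym I w p k"
  using assms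
proof (induction I arbitrary: k rule: finite_induct)
  case (insert i I)
  then show ?case by (simp add: wesym_insert)
qed (simp add: wesym_def)

lemma wesym_pos:
  assumes "finite I" "\<And>i. i \<in> I \<Longrightarrow> 0 < w i \<and> 0 < p i" "k \<le> card I"
  shows "0 < wesym I w p k"
  using assms
proof (induction I arbitrary: k rule: finite_induct)
  case (insert i I)
  have nn: "0 \<le> wesym I w p l" for l
    using insert by (intro wesym_nonneg) (auto intro: less_imp_le)
  show ?case
  proof (cases "k \<le> card I")
    case True
    then have "0 < w i * wesym I w p k" using insert by simp
    then show ?thesis using insert.hyps insert.prems(1)[of i] nn[of "k - 1"]
      by (auto simp: wesym_insert intro!: add_pos_nonneg mult_nonneg_nonneg)
  next
    case False
    then have "0 < p i * wesym I w p (k - 1)" using insert by (simp add: insert.IH)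
    moreover have "0 \<le> w i * wesym I w p k"
      using insert.prems(1)[of i] nn[of k] by (intro mult_nonneg_nonneg) (auto intro: less_imp_le)
    ultimately show ?thesis using insert.hyps False by (auto simp: wesym_insert intro!: add_nonneg_pos)
  qed
qed (simp add: wesym_def)

lemma sum_p_wesym:
  assumes "finite I"
  shows "(\<Sum>i\<in>I. p i * wesym (I - {i}) w p k) = real (Suc k) * wesym I w p (Suc k)"
proof -
  have "real (Suc k) * wesym I w p (Suc k) = coeff (pderiv (\<Prod>i\<in>I. [:w i, p i:])) k"
    by (simp add: wesym_def coeff_pderiv)
  also have "\<dots> = (\<Sum>i\<in>I. p i * wesym (I - {i}) w p k)"
    by (simp add: pderiv_prod coeff_sum pderiv_pCons wesym_def mult.commute)
  finally show ?thesis ..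
qed

text \<open>Euler's relation: \<open>wesym I w p k\<close> is homogeneous of degree
  \<open>card I - k\<close> in \<open>w\<close>, just as \<open>sum_p_wesym\<close> expresses
  homogeneity in \<open>p\<close>.\<close>

lemma sum_w_wesym:
  assumes "finite I"
  shows "(\<Sum>i\<in>I. w i * wesym (I - {i}) w p k) = (real (card I) - real k) * wesym I w p k"
proof -
  have "real (card I) * wesym I w p k = (\<Sum>i\<in>I. wesym I w p k)" by simp
  also have "\<dots> = (\<Sum>i\<in>I. w i * wesym (I - {i}) w p k + (if k = 0 then 0 else p i * wesym (I - {i}) w p (k - 1)))"
    using assms by (intro sum.cong refl wesym_remove)
  also have "\<dots> = (\<Sum>i\<in>I. w i * wesym (I - {i}) w p k) + real k * wesym I w p k"
    using sum_p_wesym[OF assms, of p w "k - 1"] by (cases k) (simp_all add: sum.distrib)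
  finally show ?thesis by (simp add: algebra_simps)
qed

text \<open>\<open>w / (w / f + p)\<close> is the parallel sum of \<open>f\<close> and
  \<open>w / p\<close>. It increases with \<open>f\<close>, so an inequality for \<open>f\<close>
  suffices. By \<open>quot\<close> it is, up to the factor \<open>1 / p\<close>, a linear function
  minus the quadratic-over-linear function \<open>w\<^sup>2 / (w + p * f)\<close>, which is jointly
  convex.\<close>

lemma parallel_sum_concave:
  fixes w1 w2 w f1 f2 f p :: real
  assumes pos: "0 < w1" "0 < w2" "0 < f1" "0 < f2" "0 < p"
    and w: "w1 + w2 = 2 * w" and f: "f1 + f2 \<le> 2 * f"
  shows "w1 / (w1 / f1 + p) + w2 / (w2 / f2 + p) \<le> 2 * (w / (w / f + p))"
proof -
  have quot: "x / (x / y + p) = (x - x\<^sup>2 / (x + p * y)) / p" if "0 < x" "0 < y" for x y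
  proof -
    have z: "x + p * y > 0" using that pos by (simp add: add_pos_pos)
    then have "x - x\<^sup>2 / (x + p * y) = p * (x * y / (x + p * y))"
      by (simp add: field_simps power2_eq_square)
    moreover have "x / y + p = (x + p * y) / y" using that by (simp add: field_simps)
    ultimately show ?thesis using pos by simp
  qed
  define a1 a2 a where "a1 = w1 + p * f1" "a2 = w2 + p * f2" "a = w + p * f"
  have a: "0 < a1" "0 < a2" using pos by (simp_all add: a1_a2_a_def add_pos_pos)
  have le: "a1 + a2 \<le> 2 * a"
    using mult_left_mono[OF f, of p] pos w by (simp add: a1_a2_a_def algebra_simps)
  have "(2 * w)\<^sup>2 / (2 * a) \<le> (2 * w)\<^sup>2 / (a1 + a2)"
    using a le by (intro divide_left_mono) auto
  also have "\<dots> = (w1 + w2)\<^sup>2 / (a1 + a2)" by (simp only: w)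
  also have "\<dots> \<le> w1\<^sup>2 / a1 + w2\<^sup>2 / a2"
  proof -
    have "(w1\<^sup>2 / a1 + w2\<^sup>2 / a2) - (w1 + w2)\<^sup>2 / (a1 + a2) = (w1 * a2 - w2 * a1)\<^sup>2 / (a1 * a2 * (a1 + a2))"
      using a by (simp add: field_simps add_pos_pos less_imp_neq[symmetric]) (simp add: power2_eq_square algebra_simps)
    moreover have "(w1 * a2 - w2 * a1)\<^sup>2 / (a1 * a2 * (a1 + a2)) \<ge> 0"
      using a by (intro divide_nonneg_nonneg mult_nonneg_nonneg) auto
    ultimately show ?thesis by linarith
  qed
  finally have "2 * (w\<^sup>2 / a) \<le> w1\<^sup>2 / a1 + w2\<^sup>2 / a2"
    by (simp add: power_mult_distrib)
  with w have "(w1 - w1\<^sup>2 / a1) + (w2 - w2\<^sup>2 / a2) \<le> 2 * (w - w\<^sup>2 / a)"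
    by (simp add: right_diff_distrib)
  then have "((w1 - w1\<^sup>2 / a1) + (w2 - w2\<^sup>2 / a2)) / p \<le> 2 * (w - w\<^sup>2 / a) / p"
    using pos by (intro divide_right_mono) auto
  moreover have "0 < f" "0 < w" using f w pos by linarith+
  ultimately show ?thesis
    using pos by (simp add: quot a1_a2_a_def add_divide_distrib)
qed

text \<open>Divide Euler's relation \<open>sum_w_wesym\<close> by
  \<open>wesym I w p (Suc k)\<close>, expanding this denominator in the \<open>i\<close>-th summand
  by \<open>wesym_remove\<close> at \<open>i\<close>. The inner ratio is written upside down because
  it is 0 when \<open>Suc k = card I\<close>.\<close>

lemma wesym_ratio_eq:
  assumes I: "finite I" "\<And>i. i \<in> I \<Longrightarrow> 0 < w i \<and> 0 < p i" and k: "k < card I"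
  shows "(real (card I) - real k) * (wesym I w p k / wesym I w p (Suc k)) =
    (\<Sum>i\<in>I. w i / (w i * (wesym (I - {i}) w p (Suc k) / wesym (I - {i}) w p k) + p i))"
proof -
  have "(real (card I) - real k) * (wesym I w p k / wesym I w p (Suc k)) =
      (\<Sum>i\<in>I. w i * wesym (I - {i}) w p k) / wesym I w p (Suc k)"
    by (simp add: sum_w_wesym[OF I(1)])
  also have "\<dots> = (\<Sum>i\<in>I. w i / (w i * (wesym (I - {i}) w p (Suc k) / wesym (I - {i}) w p k) + p i))"
    unfolding sum_divide_distrib
  proof (rule sum.cong[OF refl])
    fix i assume i: "i \<in> I"
    have e: "wesym (I - {i}) w p k > 0" using I i k by (intro wesym_pos) auto
    show "w i * wesym (I - {i}) w p k / wesym I w p (Suc k) =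
        w i / (w i * (wesym (I - {i}) w p (Suc k) / wesym (I - {i}) w p k) + p i)"
      unfolding wesym_remove[OF I(1) i, of w p "Suc k"] using e by (simp add: field_simps)
  qed
  finally show ?thesis .
qed

text \<open>Concavity of ratios of consecutive elementary symmetric functions (Marcus and Lopes): the
  ratio is an average of parallel sums of a variable with the ratio in one variable less.\<close>

lemma wesym_ratio_midpoint_concave:
  assumes "finite I" "\<And>i. i \<in> I \<Longrightarrow> 0 < m i + v i \<and> 0 < m i - v i \<and> 0 < p i" "k < card I"
  shows "wesym I (\<lambda>i. m i + v i) p k / wesym I (\<lambda>i. m i + v i) p (Suc k)
    + wesym I (\<lambda>i. m i - v i) p k / wesym I (\<lambda>i. m i - v i) p (Suc k)
    \<le> 2 * (wesym I m p k / wesym I m p (Suc k))"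
  using assms
proof (induction "card I" arbitrary: I k rule: less_induct)
  case less
  let ?a = "\<lambda>i. m i + v i" and ?b = "\<lambda>i. m i - v i"
  let ?r = "\<lambda>I w. wesym I w p k / wesym I w p (Suc k)"
  let ?t = "\<lambda>w i. w i / (w i * (wesym (I - {i}) w p (Suc k) / wesym (I - {i}) w p k) + p i)"
  have m: "0 < m i" if "i \<in> I" for i using less.prems(2)[OF that] by linarith
  have t: "?t ?a i + ?t ?b i \<le> 2 * ?t m i" if i: "i \<in> I" for i
  proof (cases "Suc k = card I")
    \<comment> \<open>Without \<open>i\<close> there is no term of index \<open>Suc k\<close>, so
      the inner ratio is 0 and the summand is \<open>w i / p i\<close>, linear in
      \<open>w\<close>.\<close>
    case True
    then have "card (I - {i}) < Suc k" using i less.prems(1) by simp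
    then have "wesym (I - {i}) w p (Suc k) = 0" for w
      using less.prems(1) by (intro wesym_eq_0) auto
    then show ?thesis by (simp add: add_divide_distrib[symmetric])
  next
    case False
    then have k: "Suc k \<le> card (I - {i})" using i less.prems by simp
    have pos: "0 < wesym (I - {i}) w p l" if "w \<in> {?a, ?b, m}" "l \<le> Suc k" for w l
      using that k less.prems(1,2) m by (intro wesym_pos) auto
    have IH: "?r (I - {i}) ?a + ?r (I - {i}) ?b \<le> 2 * ?r (I - {i}) m"
      using less.prems i k by (intro less.hyps) (auto intro!: psubset_card_mono)
    have "?a i / (?a i / ?r (I - {i}) ?a + p i) + ?b i / (?b i / ?r (I - {i}) ?b + p i)
        \<le> 2 * (m i / (m i / ?r (I - {i}) m + p i))"
      using IH less.prems(2)[OF i] pos by (intro parallel_sum_concave divide_pos_pos) auto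
    then show ?thesis by simp
  qed
  have "(real (card I) - real k) * (?r I ?a + ?r I ?b) = (\<Sum>i\<in>I. ?t ?a i) + (\<Sum>i\<in>I. ?t ?b i)"
    using less.prems by (simp only: distrib_left) (subst (1 2) wesym_ratio_eq, auto)
  also have "\<dots> \<le> (\<Sum>i\<in>I. 2 * ?t m i)"
    unfolding sum.distrib[symmetric] by (intro sum_mono t)
  also have "\<dots> = (real (card I) - real k) * (2 * ?r I m)"
    using less.prems m by (subst mult.left_commute) (subst wesym_ratio_eq, auto simp: sum_distrib_left)
  finally show ?case
    by (rule mult_left_le_imp_le) (use less.prems(3) in simp)
qed

text \<open>The value at \<open>k\<close> is a product of ratios of consecutive values and of the
  top value, the product of the \<open>p i\<close>, which is independent of \<open>w\<close>. Each
  ratio is midpoint concave, hence midpoint log-concave, and downward induction multiplies these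
  inequalities.\<close>

lemma wesym_log_midpoint_concave:
  assumes I: "finite I" "\<And>i. i \<in> I \<Longrightarrow> 0 < m i + v i \<and> 0 < m i - v i \<and> 0 < p i" and k: "k \<le> card I"
  shows "wesym I (\<lambda>i. m i + v i) p k * wesym I (\<lambda>i. m i - v i) p k \<le> (wesym I m p k)\<^sup>2"
  using k
proof (induction rule: inc_induct)
  case base
  then show ?case using I(1) by (simp add: wesym_card power2_eq_square)
next
  case (step k)
  let ?a = "wesym I (\<lambda>i. m i + v i) p" and ?b = "wesym I (\<lambda>i. m i - v i) p" and ?m = "wesym I m p"
  have m: "0 < m i" if "i \<in> I" for i using I(2)[OF that] by linarith
  have pos: "0 < ?a l" "0 < ?b l" "0 < ?m l" if "l \<le> Suc k" for l
    using that step(2) I m by (auto intro!: wesym_pos)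
  define x y z where "x = ?a k / ?a (Suc k)" "y = ?b k / ?b (Suc k)" "z = ?m k / ?m (Suc k)"
  have xyz: "0 < x" "0 < y" "0 < z" using pos by (simp_all add: x_y_z_def)
  have "x + y \<le> 2 * z"
    using wesym_ratio_midpoint_concave[OF I step(2)] by (simp add: x_y_z_def)
  then have "(x + y)\<^sup>2 \<le> (2 * z)\<^sup>2" using xyz by (intro power_mono) auto
  moreover have "4 * (x * y) \<le> (x + y)\<^sup>2" using zero_le_power2[of "x - y"] by (simp add: power2_eq_square algebra_simps)
  ultimately have "x * y \<le> z\<^sup>2" by (simp add: power_mult_distrib)
  then have "(x * y) * (?a (Suc k) * ?b (Suc k)) \<le> z\<^sup>2 * (?m (Suc k))\<^sup>2"
    using step.IH pos[of "Suc k"] by (intro mult_mono) auto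
  then show ?case using pos[of "Suc k"] by (simp add: x_y_z_def power_divide)
qed

text \<open>Applied to functions symmetrised under \<open>t \<mapsto> - t\<close>, for which a
  midpoint inequality makes 0 a maximum.\<close>

lemma second_derivative_local_max:
  fixes f f' :: "real \<Rightarrow> real"
  assumes f': "\<forall>\<^sub>F t in nhds 0. (f has_real_derivative f' t) (at t)"
    and f'': "(f' has_real_derivative D) (at 0)"
    and max: "\<forall>\<^sub>F t in nhds 0. f t \<le> f 0"
  shows "D \<le> 0"
proof (rule ccontr)
  assume "\<not> D \<le> 0"
  then obtain d1 where d1: "d1 > 0" "\<And>h. 0 < h \<Longrightarrow> h < d1 \<Longrightarrow> f' 0 < f' (0 + h)"
    using DERIV_pos_inc_right[OF f''] by auto
  obtain d2 where d2: "d2 > 0" "\<And>t. \<bar>t\<bar> < d2 \<Longrightarrow> (f has_real_derivative f' t) (at t)"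
    using f' by (auto simp: eventually_nhds_metric)
  obtain d3 where d3: "d3 > 0" "\<And>t. \<bar>t\<bar> < d3 \<Longrightarrow> f t \<le> f 0"
    using max by (auto simp: eventually_nhds_metric)
  have "f' 0 = 0"
    by (rule DERIV_local_max[OF d2(2) d3(1)]) (use d2(1) d3(2) in auto)
  define h where "h = min d1 (min d2 d3) / 2"
  have h: "0 < h" "h < d1" "h < d2" "h < d3" using d1(1) d2(1) d3(1) by (auto simp: h_def)
  have "f 0 < f h"
  proof (rule DERIV_pos_imp_increasing_open[OF h(1)])
    fix t assume t: "0 < t" "t < h"
    show "\<exists>y. (f has_real_derivative y) (at t) \<and> 0 < y"
      using d2(2)[of t] d1(2)[of t] t h \<open>f' 0 = 0\<close> by (intro exI[of _ "f' t"]) auto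
  next
    show "continuous_on {0..h} f"
      by (intro continuous_at_imp_continuous_on ballI) (rule DERIV_isCont[OF d2(2)], use h in auto)
  qed
  then show False using d3(2)[of h] h by simp
qed

lemma has_real_derivative_wesym:
  assumes "finite I" "\<And>i. i \<in> I \<Longrightarrow> ((\<lambda>t. w t i) has_real_derivative dw i) (at t)"
    "\<And>i. i \<in> I \<Longrightarrow> ((\<lambda>t. p t i) has_real_derivative dp i) (at t)"
  shows "((\<lambda>t. wesym I (w t) (p t) k) has_real_derivative
    (\<Sum>i\<in>I. dw i * wesym (I - {i}) (w t) (p t) k +
      (if k = 0 then 0 else dp i * wesym (I - {i}) (w t) (p t) (k - 1)))) (at t)"
  using assms
proof (induction I arbitrary: k rule: finite_induct)
  case empty
  then show ?case by (simp add: wesym_def)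
next
  case (insert j I)
  let ?E = "\<lambda>I. wesym I (w t) (p t)"
  let ?S = "\<lambda>I k. \<Sum>i\<in>I. dw i * ?E (I - {i}) k + (if k = 0 then 0 else dp i * ?E (I - {i}) (k - 1))"
  have IH: "((\<lambda>t. wesym I (w t) (p t) k) has_real_derivative ?S I k) (at t)" for k
    using insert by simp
  have E: "?E (insert j I - {i}) k = w t j * ?E (I - {i}) k + (if k = 0 then 0 else p t j * ?E (I - {i}) (k - 1))"
    if "i \<in> I" for i k
  proof -
    have "insert j I - {i} = insert j (I - {i})" using that insert.hyps by auto
    then show ?thesis using insert.hyps by (simp add: wesym_insert)
  qed
  have eq: "?S (insert j I) k = (dw j * ?E I k + w t j * ?S I k) +
      (if k = 0 then 0 else dp j * ?E I (k - 1) + p t j * ?S I (k - 1))"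
  proof -
    have "(\<Sum>i\<in>I. dw i * ?E (insert j I - {i}) k + (if k = 0 then 0 else dp i * ?E (insert j I - {i}) (k - 1)))
      = w t j * ?S I k + (if k = 0 then 0 else p t j * ?S I (k - 1))"
      by (auto simp: E sum_distrib_left sum.distrib[symmetric] algebra_simps intro!: sum.cong)
    then show ?thesis using insert.hyps by (simp add: algebra_simps)
  qed
  have dj: "((\<lambda>t. w t j) has_real_derivative dw j) (at t)" "((\<lambda>t. p t j) has_real_derivative dp j) (at t)"
    using insert.prems by auto
  have prod: "((\<lambda>t. w t j * wesym I (w t) (p t) k) has_real_derivative dw j * ?E I k + w t j * ?S I k) (at t)"
    "((\<lambda>t. p t j * wesym I (w t) (p t) k) has_real_derivative dp j * ?E I k + p t j * ?S I k) (at t)" for k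
    using DERIV_mult[OF dj(1) IH] DERIV_mult[OF dj(2) IH] by (simp_all only: mult.commute add.commute)
  show ?case
  proof (cases "k = 0")
    case True
    then show ?thesis
      unfolding eq unfolding wesym_insert[OF insert.hyps] using prod(1)[of 0] by simp
  next
    case False
    then show ?thesis
      unfolding eq unfolding wesym_insert[OF insert.hyps] if_not_P[OF False]
      using DERIV_add[OF prod(1)[of k] prod(2)[of "k - 1"]] by simp
  qed
qed

section \<open>Derivatives in \<open>w\<close> along lines and quadratic inequalities between
  them\<close>

lemma has_real_derivative_wesym_line:
  assumes "finite I"
  shows "((\<lambda>s. wesym I (\<lambda>i. w i + s * v i) p k) has_real_derivative
    wesym1 I (\<lambda>i. w i + s * v i) p v k) (at s)"
proof -
  have "((\<lambda>t. w i + t * v i) has_real_derivative v i) (at s)" for i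
    by (auto intro!: derivative_eq_intros)
  note has_real_derivative_wesym[where w = "\<lambda>s i. w i + s * v i" and p = "\<lambda>s. p" and k = k, OF assms this DERIV_const]
  then show ?thesis by (rule DERIV_cong) (simp add: wesym1_def cong: if_cong)
qed

lemma has_real_derivative_wesym1_line:
  assumes "finite I"
  shows "((\<lambda>s. wesym1 I (\<lambda>i. w i + s * v i) p v k) has_real_derivative
    wesym2 I (\<lambda>i. w i + s * v i) p v v k) (at s)"
  unfolding wesym1_def[of I] wesym2_def
  using assms by (intro DERIV_sum DERIV_cmult) (simp_all flip: wesym1_def add: has_real_derivative_wesym_line)

text \<open>By midpoint log-concavity \<open>Q s * Q (- s)\<close> has a local maximum at
  \<open>s = 0\<close>, and its second derivative there is twice the difference of the two
  sides.\<close>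

lemma wesym_log_concave_deriv:
  assumes I: "finite I" "\<And>i. i \<in> I \<Longrightarrow> 0 < w i \<and> 0 < p i" and k: "k \<le> card I"
  shows "wesym I w p k * wesym2 I w p v v k \<le> (wesym1 I w p v k)\<^sup>2"
proof -
  define Q where "Q s = wesym I (\<lambda>i. w i + s * v i) p k" for s
  define G where "G s = wesym1 I (\<lambda>i. w i + s * v i) p v k" for s
  define H where "H s = wesym2 I (\<lambda>i. w i + s * v i) p v v k" for s
  have Q: "(Q has_real_derivative G s) (at s)" for s
    unfolding Q_def[abs_def] G_def by (rule has_real_derivative_wesym_line[OF I(1)])
  have G: "(G has_real_derivative H s) (at s)" for s
    unfolding G_def[abs_def] H_def by (rule has_real_derivative_wesym1_line[OF I(1)])
  have Qm: "((\<lambda>s. Q (- s)) has_real_derivative - G (- s)) (at s)" for s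
    using Q[of "- s"] by (simp add: DERIV_mirror)
  have Gm: "((\<lambda>s. G (- s)) has_real_derivative - H (- s)) (at s)" for s
    using G[of "- s"] by (simp add: DERIV_mirror)
  let ?f = "\<lambda>s. Q s * Q (- s)" and ?f' = "\<lambda>s. G s * Q (- s) - Q s * G (- s)"
  have "2 * (H 0 * Q 0 - (G 0)\<^sup>2) \<le> 0"
  proof (rule second_derivative_local_max[of ?f ?f'])
    show "\<forall>\<^sub>F t in nhds 0. (?f has_real_derivative ?f' t) (at t)"
      by (intro always_eventually allI) (auto intro!: derivative_eq_intros Q Qm)
    show "(?f' has_real_derivative 2 * (H 0 * Q 0 - (G 0)\<^sup>2)) (at 0)"
      by (rule derivative_eq_intros Q Qm G Gm refl)+ (simp add: power2_eq_square algebra_simps)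
    have ev: "\<forall>\<^sub>F s in nhds 0. \<forall>i\<in>I. 0 < w i + s * v i \<and> 0 < w i - s * v i"
    proof (rule eventually_ball_finite[OF I(1)], rule ballI, rule eventually_conj)
      fix i assume i: "i \<in> I"
      have "((\<lambda>s. w i + s * v i) \<longlongrightarrow> w i + 0 * v i) (nhds 0)"
        "((\<lambda>s. w i - s * v i) \<longlongrightarrow> w i - 0 * v i) (nhds 0)"
        by (intro tendsto_intros filterlim_ident)+
      from this[THEN order_tendstoD(1), of 0]
      show "\<forall>\<^sub>F s in nhds 0. 0 < w i + s * v i" "\<forall>\<^sub>F s in nhds 0. 0 < w i - s * v i"
        using I(2)[OF i] by simp_all
    qed
    show "\<forall>\<^sub>F t in nhds 0. ?f t \<le> ?f 0"
      using ev
    proof (rule eventually_mono)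
      fix t assume "\<forall>i\<in>I. 0 < w i + t * v i \<and> 0 < w i - t * v i"
      then show "?f t \<le> ?f 0"
        using wesym_log_midpoint_concave[OF I(1) _ k, of w "\<lambda>i. t * v i" p] I(2)
        by (auto simp: Q_def power2_eq_square)
    qed
  qed
  then show ?thesis by (simp add: Q_def G_def H_def mult.commute)
qed

lemma wesym1_p: "finite I \<Longrightarrow> wesym1 I w p p k = real (Suc k) * wesym I w p (Suc k)"
  by (simp only: wesym1_def sum_p_wesym)

lemma wesym1_linear:
  "wesym1 I w p (\<lambda>i. b * v i + c * v' i) k = b * wesym1 I w p v k + c * wesym1 I w p v' k"
  by (simp add: wesym1_def sum_distrib_left sum.distrib[symmetric] algebra_simps)

lemma wesym2_commute:
  assumes "finite I"
  shows "wesym2 I w p v v' k = wesym2 I w p v' v k"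
proof -
  have "wesym2 I w p v v' k = (\<Sum>i\<in>I. \<Sum>j\<in>{j\<in>I. j \<noteq> i}. v i * v' j * wesym (I - {i, j}) w p k)" for v v'
    unfolding wesym2_def wesym1_def sum_distrib_left
    by (intro sum.cong) (auto simp: insert_commute Diff_insert2[symmetric] mult_ac)
  note eq = this
  have "wesym2 I w p v v' k = (\<Sum>j\<in>I. \<Sum>i\<in>{i\<in>I. j \<noteq> i}. v i * v' j * wesym (I - {i, j}) w p k)"
    unfolding eq by (rule sum.swap_restrict[OF assms assms])
  also have "\<dots> = wesym2 I w p v' v k"
    unfolding eq by (intro sum.cong) (auto simp: insert_commute)
  finally show ?thesis .
qed

lemma wesym2_linear:
  assumes "finite I"
  shows "wesym2 I w p (\<lambda>i. b * v i + c * v' i) (\<lambda>i. b * v i + c * v' i) k =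
    b\<^sup>2 * wesym2 I w p v v k + 2 * b * c * wesym2 I w p v' v k + c\<^sup>2 * wesym2 I w p v' v' k"
proof -
  have "wesym2 I w p (\<lambda>i. b * v i + c * v' i) (\<lambda>i. b * v i + c * v' i) k =
    b * (b * wesym2 I w p v v k + c * wesym2 I w p v v' k) + c * (b * wesym2 I w p v' v k + c * wesym2 I w p v' v' k)"
    unfolding wesym2_def[of I w p "\<lambda>i. b * v i + c * v' i"] wesym1_linear
    by (simp add: wesym2_def sum_distrib_left sum.distrib[symmetric] algebra_simps)
  then show ?thesis using wesym2_commute[OF assms, of w p v v'] by (simp add: power2_eq_square algebra_simps)
qed

lemma wesym2_p:
  assumes "finite I"
  shows "wesym2 I w p v p k = real (Suc k) * wesym1 I w p v (Suc k)"
  using assms by (simp add: wesym2_def wesym1_p wesym1_def[of I] sum_distrib_left mult_ac del: of_nat_Suc)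

text \<open>In the direction \<open>v = p\<close> Euler's relation turns differentiation into an
  index shift with factors \<open>k + 1\<close> and \<open>k + 2\<close>. Log-concavity becomes
  \<open>(k + 2) * (x * z) \<le> (k + 1) * y\<^sup>2\<close>, and the gap between the factors gives
  strictness.\<close>

lemma wesym_strict_log_concave:
  assumes I: "finite I" "\<And>i. i \<in> I \<Longrightarrow> 0 < w i \<and> 0 < p i" and k: "k + 2 \<le> card I"
  shows "wesym I w p k * wesym I w p (k + 2) < (wesym I w p (k + 1))\<^sup>2"
proof -
  define x y z where "x = wesym I w p k" "y = wesym I w p (Suc k)" "z = wesym I w p (Suc (Suc k))"
  have pos: "0 < x" "0 < z" using k by (auto simp: x_y_z_def intro!: wesym_pos I)
  have "x * (real (Suc k) * (real (Suc (Suc k)) * z)) \<le> (real (Suc k) * y)\<^sup>2"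
    using wesym_log_concave_deriv[of I w p k p] I k
    by (simp add: wesym1_p[OF I(1)] wesym2_p[OF I(1)] x_y_z_def)
  then have "real (Suc k) * (real (Suc (Suc k)) * (x * z)) \<le> real (Suc k) * (real (Suc k) * y\<^sup>2)"
    by (simp only: power2_eq_square mult_ac)
  then have "real (Suc (Suc k)) * (x * z) \<le> real (Suc k) * y\<^sup>2"
    by (rule mult_left_le_imp_le) simp
  moreover have "real (Suc k) * (x * z) < real (Suc (Suc k)) * (x * z)"
    using pos by (intro mult_strict_right_mono) auto
  ultimately have "real (Suc k) * (x * z) < real (Suc k) * y\<^sup>2" by linarith
  then have "x * z < y\<^sup>2" by (rule mult_left_less_imp_less) simp
  then show ?thesis by (simp add: x_y_z_def)
qed

text \<open>The inequality of Hillion and Johnson: apply log-concavity in the directions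
  \<open>b p + v\<close> and optimise over \<open>b\<close>.\<close>

lemma wesym_hillion_johnson:
  fixes I :: "'a set" and w p v :: "'a \<Rightarrow> real"
  assumes I: "finite I" "\<And>i. i \<in> I \<Longrightarrow> 0 < w i \<and> 0 < p i" and k: "k + 2 \<le> card I"
  defines "x \<equiv> wesym I w p k" and "y \<equiv> wesym I w p (k + 1)" and "z \<equiv> wesym I w p (k + 2)"
    and "g \<equiv> wesym1 I w p v k" and "g' \<equiv> wesym1 I w p v (k + 1)" and "h \<equiv> wesym2 I w p v v k"
  shows "h * (y\<^sup>2 - x * z) \<le> 2 * y * g * g' - z * g\<^sup>2 - x * g'\<^sup>2"
proof -
  have pos: "0 < x" "0 < z" using k by (auto simp: x_def z_def intro!: wesym_pos I)
  have quad: "0 \<le> b\<^sup>2 * (y\<^sup>2 - x * z) + 2 * b * (y * g - x * g') + (g\<^sup>2 - x * h)" for b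
  proof -
    define K where "K = real (Suc k)"
    have K: "K > 0" by (simp add: K_def)
    \<comment> \<open>Division by \<open>K\<close> normalises the direction: by Euler's relation
      \<open>(b / K) * p\<close> contributes exactly \<open>b * y\<close>.\<close>
    have g1: "wesym1 I w p (\<lambda>i. (b / K) * p i + 1 * v i) k = b * y + g"
      unfolding wesym1_linear wesym1_p[OF I(1)] using K by (simp add: K_def[symmetric] y_def g_def del: of_nat_Suc)
    have h1: "wesym2 I w p (\<lambda>i. (b / K) * p i + 1 * v i) (\<lambda>i. (b / K) * p i + 1 * v i) k =
        (b / K)\<^sup>2 * (K * ((K + 1) * z)) + 2 * b * g' + h"
      unfolding wesym2_linear[OF I(1)] wesym2_p[OF I(1)] wesym1_p[OF I(1)]
      using K by (simp add: K_def[symmetric] z_def g'_def h_def del: of_nat_Suc) (simp add: K_def)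
    have "x * ((b / K)\<^sup>2 * (K * ((K + 1) * z)) + 2 * b * g' + h) \<le> (b * y + g)\<^sup>2"
      unfolding g1[symmetric] h1[symmetric] x_def using k by (intro wesym_log_concave_deriv I) auto
    \<comment> \<open>Dropping the surplus \<open>b\<^sup>2 * z / K\<close> removes the dependence
      on \<open>K\<close>.\<close>
    moreover have "b\<^sup>2 * z \<le> (b / K)\<^sup>2 * (K * ((K + 1) * z))"
    proof -
      have "(b / K)\<^sup>2 * (K * ((K + 1) * z)) = b\<^sup>2 * z + b\<^sup>2 * z / K"
        using K by (simp add: field_simps power2_eq_square)
      then show ?thesis using pos K by simp
    qed
    then have "x * (b\<^sup>2 * z + 2 * b * g' + h) \<le> x * ((b / K)\<^sup>2 * (K * ((K + 1) * z)) + 2 * b * g' + h)"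
      using pos by (intro mult_left_mono) auto
    ultimately have "x * (b\<^sup>2 * z + 2 * b * g' + h) \<le> (b * y + g)\<^sup>2" by linarith
    then show ?thesis by (simp add: power2_eq_square algebra_simps)
  qed
  have D: "0 < y\<^sup>2 - x * z"
    using wesym_strict_log_concave[OF I k] by (simp add: x_def y_def z_def)
  define D L where "D = y\<^sup>2 - x * z" "L = y * g - x * g'"
  \<comment> \<open>\<open>- L / D\<close> minimises the quadratic polynomial in \<open>b\<close>.
    Multiplied by \<open>D\<close>, the minimum becomes divisible by \<open>x\<close>.\<close>
  have "0 \<le> D * ((- L / D)\<^sup>2 * D + 2 * (- L / D) * L + (g\<^sup>2 - x * h))"
    using quad[of "- L / D"] D by (intro mult_nonneg_nonneg) (auto simp: D_L_def)
  also have "\<dots> = D * (g\<^sup>2 - x * h) - L\<^sup>2"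
  proof -
    have "D \<noteq> 0" using D by (simp add: D_L_def)
    then show ?thesis by (simp add: D_L_def(1)[symmetric] field_simps power2_eq_square)
  qed
  also have "\<dots> = x * (2 * y * g * g' - z * g\<^sup>2 - x * g'\<^sup>2 - h * (y\<^sup>2 - x * z))"
    by (simp add: D_L_def power2_eq_square algebra_simps)
  finally have "0 \<le> 2 * y * g * g' - z * g\<^sup>2 - x * g'\<^sup>2 - h * (y\<^sup>2 - x * z)"
    using pos by (simp add: zero_le_mult_iff)
  then show ?thesis by linarith
qed

section \<open>The law of a sum of independent Bernoulli variables\<close>

lemma pmf_map_add_of_bool:
  fixes M :: "nat pmf"
  assumes "0 \<le> x" "x \<le> 1"
  shows "pmf (map_pmf (\<lambda>(y, s). of_bool y + s) (pair_pmf (bernoulli_pmf x) M)) k =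
    (1 - x) * pmf M k + (if k = 0 then 0 else x * pmf M (k - 1))"
proof -
  have "map_pmf (\<lambda>(y, s). of_bool y + s) (pair_pmf (bernoulli_pmf x) M) =
      bind_pmf (bernoulli_pmf x) (\<lambda>y. map_pmf (\<lambda>s. of_bool y + s) M)"
    by (simp add: pair_pmf_def map_bind_pmf map_pmf_def[of _ M])
  moreover have "pmf (map_pmf Suc M) k = (if k = 0 then 0 else pmf M (k - 1))"
  proof (cases k)
    case 0
    then show ?thesis by (simp add: pmf_eq_0_set_pmf)
  next
    case (Suc l)
    then show ?thesis by (simp add: pmf_map_inj')
  qed
  moreover have "(+) (Suc 0) = Suc" "(+) (0::nat) = (\<lambda>s. s)" by auto
  ultimately show ?thesis
    using assms by (simp add: pmf_bind)
qed

lemma pmf_sum_bernoulli: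
  fixes I :: "nat set"
  assumes "finite I" "\<And>i. i \<in> I \<Longrightarrow> 0 \<le> x i \<and> x i \<le> 1"
  shows "pmf (map_pmf (\<lambda>b. \<Sum>i\<in>I. of_bool (b i)) (Pi_pmf I False (\<lambda>i. bernoulli_pmf (x i)))) k =
    wesym I (\<lambda>i. 1 - x i) x k"
  using assms
proof (induction I arbitrary: k rule: finite_induct)
  case empty
  then show ?case by (simp add: wesym_def indicator_def)
next
  case (insert i I)
  let ?S = "\<lambda>I b. \<Sum>i\<in>I. of_bool (b i) :: nat"
  let ?Q = "Pi_pmf I False (\<lambda>i. bernoulli_pmf (x i))"
  have S: "?S (insert i I) (f(i := y)) = of_bool y + ?S I f" for f y
  proof -
    have "?S I (f(i := y)) = ?S I f" using insert.hyps by (intro sum.cong) auto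
    then show ?thesis using insert.hyps by (simp del: sum_of_bool_eq)
  qed
  have "map_pmf (?S (insert i I)) (Pi_pmf (insert i I) False (\<lambda>i. bernoulli_pmf (x i))) =
      map_pmf (\<lambda>(y, f). of_bool y + ?S I f) (pair_pmf (bernoulli_pmf (x i)) ?Q)"
    unfolding Pi_pmf_insert[OF insert.hyps] map_pmf_comp
  proof (intro map_pmf_cong refl)
    fix z :: "bool \<times> (nat \<Rightarrow> bool)"
    show "?S (insert i I) (case z of (y, f) \<Rightarrow> f(i := y)) = (case z of (y, f) \<Rightarrow> of_bool y + ?S I f)"
      by (cases z) (simp only: prod.case S)
  qed
  also have "\<dots> = map_pmf (\<lambda>(y, s). of_bool y + s) (pair_pmf (bernoulli_pmf (x i)) (map_pmf (?S I) ?Q))"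
    by (simp add: pair_map_pmf2 map_pmf_comp case_prod_unfold del: sum_of_bool_eq)
  finally show ?case
    using insert by (simp add: pmf_map_add_of_bool wesym_insert del: sum_of_bool_eq)
qed

subsection \<open>Strict concavity of the power sum along lines\<close>

text \<open>The operator written \<open>\<nabla>\<close> in the overview.\<close>

definition bdiff :: "(nat \<Rightarrow> real) \<Rightarrow> nat \<Rightarrow> real" where
  "bdiff u k = (if k = 0 then 0 else u (k - 1)) - u k"

lemma sum_mult_bdiff:
  "(\<Sum>k\<le>m. c k * bdiff u k) = (\<Sum>k<m. u k * (c (Suc k) - c k)) - c m * u m"
  by (induction m) (simp_all add: bdiff_def algebra_simps)

lemma sum_mult_bdiff_bdiff:
  assumes "\<And>k. N \<le> k \<Longrightarrow> h k = 0"
  shows "(\<Sum>k\<le>Suc N. c k * bdiff (bdiff h) k) = (\<Sum>k<N. h k * (c k - 2 * c (Suc k) + c (Suc (Suc k))))"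
proof -
  have "(\<Sum>k\<le>Suc N. c k * bdiff (bdiff h) k) = (\<Sum>k\<le>N. (c (Suc k) - c k) * bdiff h k)"
    using sum_mult_bdiff[of c "bdiff h" "Suc N"] assms[of N] assms[of "Suc N"] by (simp only: lessThan_Suc_atMost bdiff_def[of h "Suc N"]) (simp add: mult.commute)
  also have "\<dots> = (\<Sum>k<N. h k * (c k - 2 * c (Suc k) + c (Suc (Suc k))))"
    using assms[of N] by (subst sum_mult_bdiff) (simp add: algebra_simps)
  finally show ?thesis .
qed

text \<open>Expanding the squares gives \<open>(g k)\<^sup>2\<close> the coefficient
  \<open>\<tau> k + \<tau> (Suc k)\<close>. The share \<open>\<alpha> k\<close> goes to the form of
  index \<open>k\<close> and \<open>\<beta> k\<close> to that of index \<open>k - 1\<close>; the two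
  shares for which there is no form stay outside the sum.\<close>

lemma sum_mult_bdiff_square:
  fixes \<tau> g :: "nat \<Rightarrow> real"
  assumes split: "\<And>k. k \<le> N \<Longrightarrow> \<alpha> k + \<beta> k = \<tau> k + \<tau> (Suc k)" and "g (Suc N) = 0"
  shows "(\<Sum>k\<le>Suc N. \<tau> k * (bdiff g k)\<^sup>2) = \<beta> 0 * (g 0)\<^sup>2 + \<alpha> N * (g N)\<^sup>2 +
    (\<Sum>k<N. \<alpha> k * (g k)\<^sup>2 + \<beta> (Suc k) * (g (Suc k))\<^sup>2 - 2 * \<tau> (Suc k) * g k * g (Suc k))"
proof -
  have "(\<Sum>k\<le>N. \<tau> k * (bdiff g k)\<^sup>2) + \<tau> (Suc N) * (g N)\<^sup>2 = \<beta> 0 * (g 0)\<^sup>2 + \<alpha> N * (g N)\<^sup>2 +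
    (\<Sum>k<N. \<alpha> k * (g k)\<^sup>2 + \<beta> (Suc k) * (g (Suc k))\<^sup>2 - 2 * \<tau> (Suc k) * g k * g (Suc k))"
    using split
  proof (induction N)
    case 0
    from 0[of 0] have "\<tau> 0 + \<tau> (Suc 0) = \<alpha> 0 + \<beta> 0" by simp
    then have "(\<tau> 0 + \<tau> (Suc 0)) * (g 0)\<^sup>2 = (\<alpha> 0 + \<beta> 0) * (g 0)\<^sup>2" by simp
    then show ?case by (simp add: bdiff_def algebra_simps)
  next
    case (Suc N)
    from Suc.prems[of "Suc N"] have "\<tau> (Suc N) + \<tau> (Suc (Suc N)) = \<alpha> (Suc N) + \<beta> (Suc N)" by simp
    then have "(\<tau> (Suc N) + \<tau> (Suc (Suc N))) * (g (Suc N))\<^sup>2 = (\<alpha> (Suc N) + \<beta> (Suc N)) * (g (Suc N))\<^sup>2" by simp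
    moreover have "\<tau> (Suc N) * (bdiff g (Suc N))\<^sup>2 = \<tau> (Suc N) * (g N)\<^sup>2 + \<tau> (Suc N) * (g (Suc N))\<^sup>2
        - 2 * \<tau> (Suc N) * g N * g (Suc N)"
      by (simp add: bdiff_def power2_eq_square algebra_simps)
    moreover note Suc.IH[OF Suc.prems]
    ultimately show ?case by (simp add: distrib_right)
  qed
  then show ?thesis using assms(2) by (simp add: bdiff_def)
qed

lemma sum_wesym:
  assumes "finite I" "card I \<le> m"
  shows "(\<Sum>k\<le>m. wesym I w p k) = (\<Prod>i\<in>I. w i + p i)"
  using assms
proof (induction I arbitrary: m rule: finite_induct)
  case empty
  then show ?case by (induction m) (simp_all add: wesym_def)
next
  case (insert i I)
  then obtain l where l: "m = Suc l" "card I \<le> l" by (cases m) auto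
  have "(\<Sum>k\<le>m. wesym (insert i I) w p k) =
      w i * (\<Sum>k\<le>m. wesym I w p k) + (\<Sum>k\<le>m. if k = 0 then 0 else p i * wesym I w p (k - 1))"
    using insert.hyps by (simp add: wesym_insert sum.distrib sum_distrib_left)
  also have "(\<Sum>k\<le>m. if k = 0 then 0 else p i * wesym I w p (k - 1)) = p i * (\<Sum>k\<le>l. wesym I w p k)"
    unfolding l(1) by (subst sum.atMost_Suc_shift) (simp add: sum_distrib_left)
  finally show ?case using insert.IH[of m] insert.IH[of l] l insert.hyps by (simp add: algebra_simps)
qed

lemma sum_wesym1:
  assumes "finite I" "card I \<le> Suc m" "\<And>i. i \<in> I \<Longrightarrow> w i + p i = 1"
  shows "(\<Sum>k\<le>m. wesym1 I w p v k) = (\<Sum>i\<in>I. v i)"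
proof -
  have "(\<Sum>k\<le>m. wesym1 I w p v k) = (\<Sum>i\<in>I. v i * (\<Sum>k\<le>m. wesym (I - {i}) w p k))"
    unfolding wesym1_def sum_distrib_left by (rule sum.swap)
  also have "\<dots> = (\<Sum>i\<in>I. v i)"
    using assms by (intro sum.cong refl) (subst sum_wesym, auto)
  finally show ?thesis .
qed

text \<open>The law without two of the variables has total mass 1, which leaves the sum of
  \<open>v i * v j\<close> over \<open>i \<noteq> j\<close>. With \<open>sum_wesym1\<close> this
  recovers the sum of squares from the totals of \<open>g\<close> and \<open>h\<close>, as the
  equality case of \<open>wesym_energy\<close> requires.\<close>

lemma sum_wesym2:
  assumes I: "finite I" "card I \<le> Suc m" "\<And>i. i \<in> I \<Longrightarrow> w i + p i = 1"
  shows "(\<Sum>k\<le>m. wesym2 I w p v v k) = (\<Sum>i\<in>I. v i)\<^sup>2 - (\<Sum>i\<in>I. (v i)\<^sup>2)"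
proof -
  have "(\<Sum>k\<le>m. wesym2 I w p v v k) = (\<Sum>i\<in>I. v i * (\<Sum>k\<le>m. wesym1 (I - {i}) w p v k))"
    unfolding wesym2_def sum_distrib_left by (rule sum.swap)
  also have "\<dots> = (\<Sum>i\<in>I. v i * ((\<Sum>j\<in>I. v j) - v i))"
  proof (intro sum.cong refl)
    fix i assume i: "i \<in> I"
    have "(\<Sum>k\<le>m. wesym1 (I - {i}) w p v k) = (\<Sum>j\<in>I - {i}. v j)"
      using I by (intro sum_wesym1) (auto simp: card_Diff_singleton_if)
    then show "v i * (\<Sum>k\<le>m. wesym1 (I - {i}) w p v k) = v i * ((\<Sum>j\<in>I. v j) - v i)"
      using I i by (simp add: sum_diff1)
  qed
  also have "\<dots> = (\<Sum>i\<in>I. v i)\<^sup>2 - (\<Sum>i\<in>I. (v i)\<^sup>2)"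
    by (simp add: right_diff_distrib sum_subtractf sum_distrib_right[symmetric] power2_eq_square)
  finally show ?thesis .
qed

lemma wesym1_eq_0:
  assumes "finite I" "card I \<le> k"
  shows "wesym1 I w p v k = 0"
  unfolding wesym1_def
proof (intro sum.neutral ballI)
  fix i assume "i \<in> I"
  then have "card (I - {i}) < k" using assms by (meson card_Diff1_less less_le_trans)
  then show "v i * wesym (I - {i}) w p k = 0" using assms by (simp add: wesym_eq_0)
qed

lemma wesym2_eq_0:
  assumes "finite I" "card I \<le> Suc k"
  shows "wesym2 I w p v v' k = 0"
  unfolding wesym2_def using assms by (intro sum.neutral) (simp add: wesym1_eq_0)

text \<open>For \<open>a = 1 - q\<close>, the left side minus the right side, times
  \<open>q\<close>, is the second derivative of the power sum along a line.\<close>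

lemma wesym_energy:
  fixes I :: "'a set" and w p v :: "'a \<Rightarrow> real" and a :: real
  assumes a: "0 < a" "a < 1" and I: "finite I" "\<And>i. i \<in> I \<Longrightarrow> 0 < w i \<and> 0 < p i \<and> w i + p i = 1"
    and v: "\<exists>i\<in>I. v i \<noteq> 0"
  defines "f \<equiv> wesym I w p" and "g \<equiv> wesym1 I w p v" and "h \<equiv> wesym2 I w p v v"
  shows "(\<Sum>k\<le>card I. f k powr (- a) * bdiff (bdiff h) k) <
    a * (\<Sum>k\<le>card I. f k powr (- 1 - a) * (bdiff g k)\<^sup>2)"
proof -
  have "card I \<noteq> 0" using I(1) v by auto
  then obtain N where N: "card I = Suc N" by (cases "card I") auto
  have f: "0 < f k" if "k \<le> Suc N" for k using that N I unfolding f_def by (intro wesym_pos) auto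
  have g0: "g (Suc N) = 0" using I(1) N unfolding g_def by (intro wesym1_eq_0) auto
  have h0: "h k = 0" if "N \<le> k" for k using that I(1) N unfolding h_def by (intro wesym2_eq_0) auto
  define \<tau> where "\<tau> k = f k powr (- 1 - a)" for k
  \<comment> \<open>\<open>\<alpha> k\<close> is the share of the triple of masses starting at
    \<open>k\<close>, and \<open>\<beta> k\<close> that of the triple ending at
    \<open>Suc k\<close>.\<close>
  define \<alpha> where "\<alpha> k = \<tau> (Suc k) * edge_weight a (f (Suc k) / f k)" for k
  define \<beta> where "\<beta> k = \<tau> k * edge_weight a (f k / f (Suc k))" for k
  define Q where "Q k = \<alpha> k * (g k)\<^sup>2 + \<beta> (Suc k) * (g (Suc k))\<^sup>2 - 2 * \<tau> (Suc k) * g k * g (Suc k)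
    - h k * (f k powr (- a) - 2 * f (Suc k) powr (- a) + f (Suc (Suc k)) powr (- a)) / a" for k
  have ab: "0 < \<alpha> k" "0 < \<beta> k" "\<alpha> k + \<beta> k = \<tau> k + \<tau> (Suc k)" if k: "k \<le> N" for k
  proof -
    have fk: "0 < f k" "0 < f (Suc k)" using k by (auto intro: f)
    then show "0 < \<alpha> k" "0 < \<beta> k" by (simp_all add: \<alpha>_def \<beta>_def \<tau>_def edge_weight_pos[OF a])
    have \<tau>: "\<tau> (Suc k) = \<tau> k * (f (Suc k) / f k) powr (- 1 - a)"
      using fk by (simp add: \<tau>_def powr_divide)
    then have "\<alpha> k + \<beta> k = \<tau> k * ((f (Suc k) / f k) powr (- 1 - a) * edge_weight a (f (Suc k) / f k)
        + edge_weight a (1 / (f (Suc k) / f k)))"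
      by (simp add: \<alpha>_def \<beta>_def algebra_simps)
    also have "\<dots> = \<tau> k + \<tau> (Suc k)"
      using fk \<tau> by (subst edge_weight_reflect[OF a]) (auto simp: algebra_simps)
    finally show "\<alpha> k + \<beta> k = \<tau> k + \<tau> (Suc k)" .
  qed
  have Q: "0 \<le> Q k" "Q k = 0 \<Longrightarrow> g k = 0 \<and> g (Suc k) = 0 \<and> h k = 0" if k: "k < N" for k
  proof -
    have pos: "0 < f k" "0 < f (Suc k)" "0 < f (Suc (Suc k))" using k by (auto intro: f)
    have lc: "f k * f (Suc (Suc k)) < (f (Suc k))\<^sup>2"
      using wesym_strict_log_concave[of I w p k] I k N by (simp add: f_def)
    have key: "h k * ((f (Suc k))\<^sup>2 - f k * f (Suc (Suc k))) \<le>
        2 * f (Suc k) * g k * g (Suc k) - f (Suc (Suc k)) * (g k)\<^sup>2 - f k * (g (Suc k))\<^sup>2"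
      using wesym_hillion_johnson[of I w p k v] I k N by (simp add: f_def g_def h_def)
    show "0 \<le> Q k" "Q k = 0 \<Longrightarrow> g k = 0 \<and> g (Suc k) = 0 \<and> h k = 0"
      using local_energy[OF a pos lc key] by (simp_all add: Q_def \<alpha>_def \<beta>_def \<tau>_def)
  qed
  let ?R = "\<beta> 0 * (g 0)\<^sup>2 + \<alpha> N * (g N)\<^sup>2 + (\<Sum>k<N. Q k)"
  have R: "(\<Sum>k\<le>card I. \<tau> k * (bdiff g k)\<^sup>2) - (\<Sum>k\<le>card I. f k powr (- a) * bdiff (bdiff h) k) / a = ?R"
  proof -
    have "(\<Sum>k\<le>card I. f k powr (- a) * bdiff (bdiff h) k) =
        (\<Sum>k<N. h k * (f k powr (- a) - 2 * f (Suc k) powr (- a) + f (Suc (Suc k)) powr (- a)))"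
      unfolding N by (rule sum_mult_bdiff_bdiff[OF h0])
    moreover have "(\<Sum>k\<le>card I. \<tau> k * (bdiff g k)\<^sup>2) = \<beta> 0 * (g 0)\<^sup>2 + \<alpha> N * (g N)\<^sup>2 +
        (\<Sum>k<N. \<alpha> k * (g k)\<^sup>2 + \<beta> (Suc k) * (g (Suc k))\<^sup>2 - 2 * \<tau> (Suc k) * g k * g (Suc k))"
      unfolding N by (rule sum_mult_bdiff_square, rule ab(3), assumption, rule g0)
    ultimately show ?thesis by (simp add: Q_def sum_subtractf sum_divide_distrib)
  qed
  have nn: "0 \<le> \<beta> 0 * (g 0)\<^sup>2" "0 \<le> \<alpha> N * (g N)\<^sup>2" "0 \<le> (\<Sum>k<N. Q k)"
    using ab(1)[of N] ab(2)[of 0] Q(1) by (auto intro: sum_nonneg less_imp_le)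
  have "0 < ?R"
  proof (rule ccontr)
    assume "\<not> 0 < ?R"
    with nn have z: "\<alpha> N * (g N)\<^sup>2 = 0" "(\<Sum>k<N. Q k) = 0" by linarith+
    have "Q k = 0" if "k < N" for k
      using z(2) Q(1) that by (subst (asm) sum_nonneg_eq_0_iff) auto
    \<comment> \<open>The boundary term with \<open>\<alpha> N\<close> takes care of
      \<open>g N\<close>, also for \<open>N = 0\<close>, where there are no forms at all.\<close>
    then have gh: "g k = 0 \<and> h k = 0" if "k \<le> N" for k
      using that Q(2)[of k] z(1) ab(1)[of N] h0[of k] by (cases "k < N") auto
    have "(\<Sum>k\<le>N. wesym1 I w p v k) = (\<Sum>i\<in>I. v i)"
      using I N by (intro sum_wesym1) auto
    moreover have "(\<Sum>k\<le>N. wesym2 I w p v v k) = (\<Sum>i\<in>I. v i)\<^sup>2 - (\<Sum>i\<in>I. (v i)\<^sup>2)"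
      using I N by (intro sum_wesym2) auto
    ultimately have "(\<Sum>i\<in>I. (v i)\<^sup>2) = 0" using gh by (simp add: g_def h_def)
    then show False using v I(1) by (simp add: sum_nonneg_eq_0_iff)
  qed
  then have "(\<Sum>k\<le>card I. f k powr (- a) * bdiff (bdiff h) k) / a < (\<Sum>k\<le>card I. \<tau> k * (bdiff g k)\<^sup>2)"
    using R by linarith
  then show ?thesis using a by (simp add: \<tau>_def field_simps)
qed

lemma strictly_concave_unit_interval:
  fixes f f' f'' :: "real \<Rightarrow> real"
  assumes f': "\<And>t. 0 \<le> t \<Longrightarrow> t \<le> 1 \<Longrightarrow> (f has_real_derivative f' t) (at t)"
    and f'': "\<And>t. 0 \<le> t \<Longrightarrow> t \<le> 1 \<Longrightarrow> (f' has_real_derivative f'' t) (at t)"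
    and neg: "\<And>t. 0 \<le> t \<Longrightarrow> t \<le> 1 \<Longrightarrow> f'' t < 0"
    and s: "0 < s" "s < 1"
  shows "(1 - s) * f 0 + s * f 1 < f s"
proof -
  obtain c where c: "0 < c" "c < s" "f s - f 0 = (s - 0) * f' c"
    using MVT2[of 0 s f f'] s f' by auto
  obtain d where d: "s < d" "d < 1" "f 1 - f s = (1 - s) * f' d"
    using MVT2[of s 1 f f'] s f' by auto
  have "f' d < f' c"
  proof (rule DERIV_neg_imp_decreasing[where f = f'])
    show "c < d" using c d by simp
    fix t assume "c \<le> t" "t \<le> d"
    then show "\<exists>y. (f' has_real_derivative y) (at t) \<and> y < 0"
      using f''[of t] neg[of t] c d by (intro exI[of _ "f'' t"]) auto
  qed
  then have "s * (1 - s) * f' d < s * (1 - s) * f' c" using s by (intro mult_strict_left_mono) auto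
  moreover have "(1 - s) * (f s - f 0) = s * (1 - s) * f' c" "s * (f 1 - f s) = s * (1 - s) * f' d"
    unfolding c(3) d(3) by simp_all
  ultimately have "s * (f 1 - f s) < (1 - s) * (f s - f 0)" by linarith
  then show ?thesis by (simp add: algebra_simps)
qed

lemma has_real_derivative_bdiff:
  assumes "\<And>k. ((\<lambda>t. u t k) has_real_derivative u' k) (at t)"
  shows "((\<lambda>t. bdiff (u t) k) has_real_derivative bdiff u' k) (at t)"
  unfolding bdiff_def by (cases "k = 0") (auto intro!: DERIV_diff DERIV_minus assms)

lemma wesym_power_sum_strictly_concave:
  fixes x y :: "'a \<Rightarrow> real" and q s :: real
  assumes q: "0 < q" "q < 1" and I: "finite I"
    and xy: "\<And>i. i \<in> I \<Longrightarrow> 0 < x i \<and> x i < 1 \<and> 0 < y i \<and> y i < 1" and ne: "\<exists>i\<in>I. x i \<noteq> y i"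
    and s: "0 < s" "s < 1"
  defines "F \<equiv> \<lambda>t. \<Sum>k\<le>card I. wesym I (\<lambda>i. 1 - (x i + t * (y i - x i))) (\<lambda>i. x i + t * (y i - x i)) k powr q"
  shows "(1 - s) * F 0 + s * F 1 < F s"
proof -
  define v where "v i = y i - x i" for i
  have v: "\<exists>i\<in>I. v i \<noteq> 0" using ne by (force simp: v_def)
  define p where "p t i = x i + t * v i" for t i
  define w where "w t i = 1 - p t i" for t i
  define f where "f t = wesym I (w t) (p t)" for t
  define g where "g t = wesym1 I (w t) (p t) v" for t
  define h where "h t = wesym2 I (w t) (p t) v v" for t
  have p': "((\<lambda>t. p t i) has_real_derivative v i) (at t)"
    and w': "((\<lambda>t. w t i) has_real_derivative - v i) (at t)" for i t
    unfolding p_def w_def by (auto intro!: derivative_eq_intros)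
  \<comment> \<open>Along the path \<open>w\<close> moves with velocity \<open>- v\<close> and
    \<open>p\<close> with velocity \<open>v\<close>; the two contributions combine to
    \<open>bdiff\<close>.\<close>
  have E': "((\<lambda>t. wesym J (w t) (p t) k) has_real_derivative bdiff (wesym1 J (w t) (p t) v) k) (at t)"
    if "finite J" for J k t
    by (rule DERIV_cong[OF has_real_derivative_wesym[OF that w' p']])
      (auto simp: bdiff_def wesym1_def sum_negf sum_subtractf[symmetric] intro!: sum.cong)
  have f': "((\<lambda>t. f t k) has_real_derivative bdiff (g t) k) (at t)" for k t
    unfolding f_def g_def by (rule E'[OF I])
  have g': "((\<lambda>t. g t k) has_real_derivative bdiff (h t) k) (at t)" for k t
  proof -
    have "((\<lambda>t. g t k) has_real_derivative (\<Sum>i\<in>I. v i * bdiff (wesym1 (I - {i}) (w t) (p t) v) k)) (at t)"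
      unfolding g_def wesym1_def[of I] using I by (intro DERIV_sum DERIV_cmult E') auto
    moreover have "(\<Sum>i\<in>I. v i * bdiff (wesym1 (I - {i}) (w t) (p t) v) k) = bdiff (h t) k"
      by (auto simp: bdiff_def h_def wesym2_def right_diff_distrib sum_subtractf sum_negf)
    ultimately show ?thesis by simp
  qed
  have pw: "0 < w t i \<and> 0 < p t i \<and> w t i + p t i = 1" if "i \<in> I" "0 \<le> t" "t \<le> 1" for t i
  proof -
    have "p t i = (1 - t) * x i + t * y i" "w t i = (1 - t) * (1 - x i) + t * (1 - y i)"
      by (simp_all add: p_def w_def v_def algebra_simps)
    moreover have "0 < (1 - t) * a + t * b" if "0 < a" "0 < b" for a b
      using that \<open>0 \<le> t\<close> \<open>t \<le> 1\<close>
      by (cases "t = 0") (auto intro!: add_nonneg_pos mult_nonneg_nonneg mult_pos_pos)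
    ultimately show ?thesis using xy[OF that(1)] by (simp add: w_def)
  qed
  have fpos: "0 < f t k" if "0 \<le> t" "t \<le> 1" "k \<le> card I" for t k
    unfolding f_def using that I pw by (intro wesym_pos) auto
  define F' where "F' t = (\<Sum>k\<le>card I. q * f t k powr (q - 1) * bdiff (g t) k)" for t
  define F'' where "F'' t = (\<Sum>k\<le>card I. q * (f t k powr (q - 1) * bdiff (bdiff (h t)) k
    + (q - 1) * (f t k powr (q - 2) * (bdiff (g t) k)\<^sup>2)))" for t
  have F: "F = (\<lambda>t. \<Sum>k\<le>card I. f t k powr q)"
    by (simp add: F_def f_def w_def[abs_def] p_def[abs_def] v_def)
  show ?thesis
  proof (rule strictly_concave_unit_interval[of F F' F'', OF _ _ _ s])
    fix t :: real assume t: "0 \<le> t" "t \<le> 1"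
    show "(F has_real_derivative F' t) (at t)"
      unfolding F F'_def
      by (intro DERIV_sum DERIV_cong[OF DERIV_chain2[OF has_real_derivative_powr f']]) (use t fpos in auto)
    have "((\<lambda>t. q * f t k powr (q - 1) * bdiff (g t) k) has_real_derivative
        q * (f t k powr (q - 1) * bdiff (bdiff (h t)) k + (q - 1) * (f t k powr (q - 2) * (bdiff (g t) k)\<^sup>2))) (at t)"
      if k: "k \<le> card I" for k
    proof -
      have 1: "((\<lambda>t. f t k powr (q - 1)) has_real_derivative (q - 1) * f t k powr (q - 1 - 1) * bdiff (g t) k) (at t)"
        by (rule DERIV_chain2[OF has_real_derivative_powr f']) (use t fpos k in auto)
      have 2: "((\<lambda>t. bdiff (g t) k) has_real_derivative bdiff (bdiff (h t)) k) (at t)"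
        by (rule has_real_derivative_bdiff[OF g'])
      show ?thesis
        by (rule DERIV_cong[OF DERIV_mult[OF DERIV_cmult[OF 1, of q] 2]])
          (simp add: power2_eq_square algebra_simps)
    qed
    then show "(F' has_real_derivative F'' t) (at t)"
      unfolding F'_def F''_def by (intro DERIV_sum) auto
    have "(\<Sum>k\<le>card I. f t k powr (- (1 - q)) * bdiff (bdiff (h t)) k) <
        (1 - q) * (\<Sum>k\<le>card I. f t k powr (- 1 - (1 - q)) * (bdiff (g t) k)\<^sup>2)"
      unfolding f_def g_def h_def
      by (rule wesym_energy) (use q I pw[OF _ t] v in auto)
    then have "q * ((\<Sum>k\<le>card I. f t k powr (q - 1) * bdiff (bdiff (h t)) k)
        + (q - 1) * (\<Sum>k\<le>card I. f t k powr (q - 2) * (bdiff (g t) k)\<^sup>2)) < 0"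
      using q by (intro mult_pos_neg) (simp_all add: algebra_simps)
    then show "F'' t < 0"
      by (simp add: F''_def sum_distrib_left[symmetric] sum.distrib)
  qed
qed

subsection \<open>Concavity on the cube\<close>

lemma lookup_scaleR [simp]: "Poly_Mapping.lookup (r *\<^sub>R x) i = r *\<^sub>R Poly_Mapping.lookup x i"
proof -
  have "finite {i. r *\<^sub>R Poly_Mapping.lookup x i \<noteq> 0}"
    by (rule finite_subset[OF _ finite_lookup[of x]]) auto
  then show ?thesis by (simp add: scaleR_poly_mapping_def)
qed

lemma mem_unit_cube: "p \<in> unit_cube n \<longleftrightarrow> (\<forall>i. i \<notin> {1..n} \<longrightarrow> Poly_Mapping.lookup p i = 0) \<and>
    (\<forall>i\<in>{1..n}. 0 \<le> Poly_Mapping.lookup p i \<and> Poly_Mapping.lookup p i \<le> 1)"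
  by (auto simp: unit_cube_def subset_iff in_keys_iff)

lemma mem_open_unit_cube: "p \<in> open_unit_cube n \<longleftrightarrow> (\<forall>i. i \<notin> {1..n} \<longrightarrow> Poly_Mapping.lookup p i = 0) \<and>
    (\<forall>i\<in>{1..n}. 0 < Poly_Mapping.lookup p i \<and> Poly_Mapping.lookup p i < 1)"
  by (auto simp: open_unit_cube_def subset_iff in_keys_iff)

lemma open_unit_cube_subset: "open_unit_cube n \<subseteq> unit_cube n"
  by (auto simp: mem_unit_cube mem_open_unit_cube less_imp_le)

lemma convex_unit_cube: "convex (unit_cube n)"
proof (rule convexI)
  fix x y :: "nat \<Rightarrow>\<^sub>0 real" and u v :: real
  assume xy: "x \<in> unit_cube n" "y \<in> unit_cube n" and uv: "0 \<le> u" "0 \<le> v" "u + v = 1"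
  have "u * Poly_Mapping.lookup x i + v * Poly_Mapping.lookup y i \<le> 1" if "i \<in> {1..n}" for i
    using xy uv that by (intro convex_bound_le) (auto simp: mem_unit_cube)
  then show "u *\<^sub>R x + v *\<^sub>R y \<in> unit_cube n"
    using xy uv by (auto simp: mem_unit_cube lookup_add)
qed

lemma convex_open_unit_cube: "convex (open_unit_cube n)"
proof (rule convexI)
  fix x y :: "nat \<Rightarrow>\<^sub>0 real" and u v :: real
  assume xy: "x \<in> open_unit_cube n" "y \<in> open_unit_cube n" and uv: "0 \<le> u" "0 \<le> v" "u + v = 1"
  have "u * Poly_Mapping.lookup x i + v * Poly_Mapping.lookup y i < 1" if "i \<in> {1..n}" for i
    using xy uv that by (intro convex_bound_lt) (auto simp: mem_open_unit_cube)
  moreover have "0 < u * Poly_Mapping.lookup x i + v * Poly_Mapping.lookup y i" if "i \<in> {1..n}" for i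
  proof -
    have "0 < Poly_Mapping.lookup x i" "0 < Poly_Mapping.lookup y i"
      using xy that by (auto simp: mem_open_unit_cube)
    then show ?thesis using uv by (cases "u = 0") (simp_all add: add_pos_nonneg)
  qed
  ultimately show "u *\<^sub>R x + v *\<^sub>R y \<in> open_unit_cube n"
    using xy uv by (auto simp: mem_open_unit_cube lookup_add)
qed

definition bernoulli_sum_mass :: "nat \<Rightarrow> (nat \<Rightarrow>\<^sub>0 real) \<Rightarrow> nat \<Rightarrow> real" where
  "bernoulli_sum_mass n p k =
    wesym {1..n} (\<lambda>i. 1 - Poly_Mapping.lookup p i) (Poly_Mapping.lookup p) k"

lemma pmf_bernoulli_sum_pmf:
  assumes "p \<in> unit_cube n"
  shows "pmf (bernoulli_sum_pmf n p) k = bernoulli_sum_mass n p k"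
  unfolding bernoulli_sum_pmf_def bernoulli_sum_mass_def
  using assms by (intro pmf_sum_bernoulli) (auto simp: mem_unit_cube)

lemma power_sum_bernoulli_sum_pmf:
  assumes "p \<in> unit_cube n"
  shows "power_sum q n (bernoulli_sum_pmf n p) = (\<Sum>k\<le>n. bernoulli_sum_mass n p k powr q)"
  by (simp add: power_sum_def pmf_bernoulli_sum_pmf[OF assms] atLeast0AtMost)

text \<open>The masses add up to 1, so one of them is nonzero. This makes the logarithm in the Renyi
  entropy meaningful.\<close>

lemma power_sum_pos:
  assumes "p \<in> unit_cube n"
  shows "0 < power_sum q n (bernoulli_sum_pmf n p)"
proof -
  have "(\<Sum>k\<le>n. bernoulli_sum_mass n p k) = 1"
    unfolding bernoulli_sum_mass_def by (subst sum_wesym) simp_all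
  then obtain k where k: "k \<le> n" "bernoulli_sum_mass n p k \<noteq> 0"
    by (metis atMost_iff sum.neutral zero_neq_one)
  then have "0 < (\<Sum>k\<le>n. bernoulli_sum_mass n p k powr q)"
    by (intro sum_pos2[of _ k]) auto
  then show ?thesis using power_sum_bernoulli_sum_pmf[OF assms] by simp
qed

lemma power_sum_strictly_concave_on_open_unit_cube:
  assumes q: "0 < q" "q < 1"
  shows "strictly_concave_on (open_unit_cube n) (\<lambda>p. power_sum q n (bernoulli_sum_pmf n p))"
  unfolding strictly_concave_on_def
proof (intro conjI convex_open_unit_cube ballI impI allI)
  fix x y :: "nat \<Rightarrow>\<^sub>0 real" and u v :: real
  assume xy: "x \<in> open_unit_cube n" "y \<in> open_unit_cube n" "x \<noteq> y" and uv: "0 < u" "0 < v" "u + v = 1"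
  let ?z = "u *\<^sub>R x + v *\<^sub>R y"
  let ?X = "Poly_Mapping.lookup x" and ?Y = "Poly_Mapping.lookup y"
  define F where "F t = (\<Sum>k\<le>card {1..n}. wesym {1..n} (\<lambda>i. 1 - (?X i + t * (?Y i - ?X i)))
      (\<lambda>i. ?X i + t * (?Y i - ?X i)) k powr q)" for t
  have z: "?z \<in> open_unit_cube n"
    using convexD[OF convex_open_unit_cube xy(1,2)] uv by simp
  have ne: "\<exists>i\<in>{1..n}. ?X i \<noteq> ?Y i"
    using xy by (metis mem_open_unit_cube poly_mapping_eqI)
  have "(1 - v) * F 0 + v * F 1 < F v"
    unfolding F_def by (rule wesym_power_sum_strictly_concave[OF q])
      (use xy(1,2) uv ne in \<open>auto simp: mem_open_unit_cube\<close>)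
  moreover have P: "power_sum q n (bernoulli_sum_pmf n p) = F t"
    if "p \<in> open_unit_cube n" "\<And>i. Poly_Mapping.lookup p i = ?X i + t * (?Y i - ?X i)" for p t
  proof -
    have "p \<in> unit_cube n" using that open_unit_cube_subset by auto
    then show ?thesis
      by (simp add: power_sum_bernoulli_sum_pmf F_def bernoulli_sum_mass_def that(2)[abs_def] ext[OF that(2)])
  qed
  have "u = 1 - v" using uv by simp
  then have "power_sum q n (bernoulli_sum_pmf n ?z) = F v"
    by (intro P z) (simp only: lookup_add lookup_scaleR real_scaleR_def, simp add: \<open>u = 1 - v\<close> algebra_simps)
  moreover have "power_sum q n (bernoulli_sum_pmf n x) = F 0" "power_sum q n (bernoulli_sum_pmf n y) = F 1"
    by (intro P xy; simp)+
  ultimately show "power_sum q n (bernoulli_sum_pmf n ?z) >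
      u * power_sum q n (bernoulli_sum_pmf n x) + v * power_sum q n (bernoulli_sum_pmf n y)"
    using \<open>u = 1 - v\<close> by simp
qed

section \<open>Passage from the open to the closed cube\<close>

definition cube_center :: "nat \<Rightarrow> nat \<Rightarrow>\<^sub>0 real" where
  "cube_center n = (\<Sum>i\<in>{1..n}. Poly_Mapping.single i (1 / 2))"

lemma lookup_cube_center: "Poly_Mapping.lookup (cube_center n) i = (if i \<in> {1..n} then 1 / 2 else 0)"
  by (simp add: cube_center_def lookup_sum lookup_single when_def)

lemma shrink_in_open_unit_cube:
  assumes "x \<in> unit_cube n" "0 < t" "t < 1"
  shows "(1 - t) *\<^sub>R x + t *\<^sub>R cube_center n \<in> open_unit_cube n"
proof -
  have "0 < (1 - t) * Poly_Mapping.lookup x i + t / 2 \<and> (1 - t) * Poly_Mapping.lookup x i + t / 2 < 1"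
    if "i \<in> {1..n}" for i
  proof -
    define A where "A = (1 - t) * Poly_Mapping.lookup x i"
    have "0 \<le> Poly_Mapping.lookup x i" "Poly_Mapping.lookup x i \<le> 1" using assms(1) that by (auto simp: mem_unit_cube)
    then have "0 \<le> A" "A \<le> 1 - t"
      using assms(2,3) mult_left_mono[of "Poly_Mapping.lookup x i" 1 "1 - t"] by (simp_all add: A_def)
    moreover have "0 < t / 2" "t / 2 < t" using assms(2) by simp_all
    ultimately have "0 < A + t / 2" "A + t / 2 < 1" by linarith+
    then show ?thesis by (simp add: A_def)
  qed
  then show ?thesis using assms(1)
    by (auto simp: mem_unit_cube mem_open_unit_cube lookup_add lookup_cube_center)
qed

lemma tendsto_power_sum_shrink:
  assumes q: "0 < q" and x: "x \<in> unit_cube n"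
  shows "((\<lambda>t. power_sum q n (bernoulli_sum_pmf n ((1 - t) *\<^sub>R x + t *\<^sub>R cube_center n))) \<longlongrightarrow>
    power_sum q n (bernoulli_sum_pmf n x)) (at_right 0)"
proof -
  let ?X = "Poly_Mapping.lookup x" and ?C = "Poly_Mapping.lookup (cube_center n)"
  define z where "z t = (1 - t) *\<^sub>R x + t *\<^sub>R cube_center n" for t
  have ev: "\<forall>\<^sub>F t in at_right 0. z t \<in> unit_cube n"
    using eventually_at_right_real[OF zero_less_one]
    by eventually_elim (use shrink_in_open_unit_cube[OF x] open_unit_cube_subset in \<open>auto simp: z_def\<close>)
  have lz: "Poly_Mapping.lookup (z t) = (\<lambda>i. (1 - t) * ?X i + t * ?C i)" for t
    by (simp add: z_def lookup_add fun_eq_iff)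
  have "((\<lambda>t. \<Sum>k\<le>n. bernoulli_sum_mass n (z t) k powr q) \<longlongrightarrow> (\<Sum>k\<le>n. bernoulli_sum_mass n x k powr q)) (at_right 0)"
  proof (intro tendsto_sum tendsto_powr' tendsto_const)
    fix k
    have "((\<lambda>t. bernoulli_sum_mass n (z t) k) has_real_derivative
        (\<Sum>i\<in>{1..n}. - (?C i - ?X i) * wesym ({1..n} - {i}) (\<lambda>i. 1 - ((1 - 0) * ?X i + 0 * ?C i)) (\<lambda>i. (1 - 0) * ?X i + 0 * ?C i) k +
        (if k = 0 then 0 else (?C i - ?X i) * wesym ({1..n} - {i}) (\<lambda>i. 1 - ((1 - 0) * ?X i + 0 * ?C i)) (\<lambda>i. (1 - 0) * ?X i + 0 * ?C i) (k - 1)))) (at 0)"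
      unfolding bernoulli_sum_mass_def lz
      by (rule has_real_derivative_wesym[of _ "\<lambda>t i. 1 - ((1 - t) * ?X i + t * ?C i)" _ _ "\<lambda>t i. (1 - t) * ?X i + t * ?C i"])
        (auto intro!: derivative_eq_intros)
    then have "((\<lambda>t. bernoulli_sum_mass n (z t) k) \<longlongrightarrow> bernoulli_sum_mass n (z 0) k) (at 0)"
      by (rule DERIV_isCont[unfolded isCont_def])
    then show "((\<lambda>t. bernoulli_sum_mass n (z t) k) \<longlongrightarrow> bernoulli_sum_mass n x k) (at_right 0)"
      by (auto simp: z_def intro: tendsto_within_subset)
    \<comment> \<open>The limit mass may be 0; continuity of \<open>powr\<close> at base 0 then
      rests on a positive exponent and nonnegative bases.\<close>
    have "\<forall>\<^sub>F t in at_right 0. 0 \<le> bernoulli_sum_mass n (z t) k"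
      using ev by eventually_elim (simp flip: pmf_bernoulli_sum_pmf)
    then show "bernoulli_sum_mass n x k \<noteq> 0 \<or> 0 < q \<and> (\<forall>\<^sub>F t in at_right 0. 0 \<le> bernoulli_sum_mass n (z t) k)"
      using q by simp
  qed
  then have "((\<lambda>t. power_sum q n (bernoulli_sum_pmf n (z t))) \<longlongrightarrow> power_sum q n (bernoulli_sum_pmf n x)) (at_right 0)"
    unfolding power_sum_bernoulli_sum_pmf[OF x]
    by (rule Lim_transform_eventually)
      (use ev in eventually_elim, simp add: power_sum_bernoulli_sum_pmf)
  then show ?thesis by (simp add: z_def)
qed

text \<open>On the boundary masses may vanish, where the derivatives break down. Shrinking towards
  the centre moves every point into the open cube and commutes with convex combinations, so the
  inequality passes to the limit.\<close>

lemma power_sum_concave_on_unit_cube: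
  assumes q: "0 < q" "q < 1"
  shows "concave_on (unit_cube n) (\<lambda>p. power_sum q n (bernoulli_sum_pmf n p))"
  unfolding concave_on_iff
proof (intro conjI convex_unit_cube ballI impI allI)
  fix x y :: "nat \<Rightarrow>\<^sub>0 real" and u v :: real
  assume x: "x \<in> unit_cube n" and y: "y \<in> unit_cube n" and uv: "0 \<le> u" "0 \<le> v" "u + v = 1"
  let ?P = "\<lambda>p. power_sum q n (bernoulli_sum_pmf n p)"
  let ?s = "\<lambda>x t. (1 - t) *\<^sub>R x + t *\<^sub>R cube_center n"
  have xy: "u *\<^sub>R x + v *\<^sub>R y \<in> unit_cube n" using convexD[OF convex_unit_cube x y] uv by simp
  have s: "?s (u *\<^sub>R x + v *\<^sub>R y) t = u *\<^sub>R ?s x t + v *\<^sub>R ?s y t" for t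
  proof -
    have "u = 1 - v" using uv by simp
    then show ?thesis
      by (intro poly_mapping_eqI) (simp only: lookup_add lookup_scaleR real_scaleR_def, simp add: algebra_simps)
  qed
  show "u * ?P x + v * ?P y \<le> ?P (u *\<^sub>R x + v *\<^sub>R y)"
  proof (rule tendsto_le[OF _ tendsto_power_sum_shrink[OF q(1) xy]])
    show "((\<lambda>t. u * ?P (?s x t) + v * ?P (?s y t)) \<longlongrightarrow> u * ?P x + v * ?P y) (at_right 0)"
      by (intro tendsto_intros tendsto_power_sum_shrink q x y)
    have "\<forall>\<^sub>F t in at_right (0::real). 0 < t \<and> t < 1"
      using eventually_at_right_real[of 0 1] by (auto elim: eventually_mono)
    then show "\<forall>\<^sub>F t in at_right 0. u * ?P (?s x t) + v * ?P (?s y t) \<le> ?P (?s (u *\<^sub>R x + v *\<^sub>R y) t)"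
    proof eventually_elim
      case (elim t)
      have sxy: "?s x t \<in> open_unit_cube n" "?s y t \<in> open_unit_cube n"
        using elim by (auto intro!: shrink_in_open_unit_cube x y)
      show ?case
      \<comment> \<open>Strict concavity speaks of distinct points and positive weights; in the
        remaining cases equality holds.\<close>
      proof (cases "u = 0 \<or> v = 0 \<or> ?s x t = ?s y t")
        case True
        then have "u * ?P (?s x t) + v * ?P (?s y t) = ?P (u *\<^sub>R ?s x t + v *\<^sub>R ?s y t)"
        proof (elim disjE)
          assume "?s x t = ?s y t"
          then show ?thesis using uv(3) by (simp only: scaleR_add_left[symmetric] distrib_right[symmetric]) simp
        qed (use uv in auto)
        then show ?thesis unfolding s by simp
      next
        case False
        then show ?thesis
          unfolding s using power_sum_strictly_concave_on_open_unit_cube[OF q, of n] sxy uv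
          by (auto simp: strictly_concave_on_def intro: less_imp_le)
      qed
    qed
  qed simp
qed

section \<open>From the power sum to the entropies\<close>

lemma tsallis_entropy_eq: "q \<noteq> 1 \<Longrightarrow> tsallis_entropy q n P = (power_sum q n P - 1) / (1 - q)"
  by (simp add: tsallis_entropy_def field_simps)

lemma tsallis_concave_on_unit_cube:
  assumes q: "0 < q" "q < 1"
  shows "concave_on (unit_cube n) (\<lambda>p. tsallis_entropy q n (bernoulli_sum_pmf n p))"
  unfolding concave_on_iff
proof (intro conjI convex_unit_cube ballI impI allI)
  fix x y :: "nat \<Rightarrow>\<^sub>0 real" and u v :: real
  assume a: "x \<in> unit_cube n" "y \<in> unit_cube n" "0 \<le> u" "0 \<le> v" "u + v = 1"
  let ?P = "\<lambda>p. power_sum q n (bernoulli_sum_pmf n p)"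
  have "u * ?P x + v * ?P y \<le> ?P (u *\<^sub>R x + v *\<^sub>R y)"
    using power_sum_concave_on_unit_cube[OF q, of n] a unfolding concave_on_iff by blast
  then have "(u * ?P x + v * ?P y - (u + v)) / (1 - q) \<le> (?P (u *\<^sub>R x + v *\<^sub>R y) - 1) / (1 - q)"
    using q a by (intro divide_right_mono) auto
  also have "(u * ?P x + v * ?P y - (u + v)) / (1 - q) = u * ((?P x - 1) / (1 - q)) + v * ((?P y - 1) / (1 - q))"
    by (simp add: add_divide_distrib[symmetric] algebra_simps)
  finally show "u * tsallis_entropy q n (bernoulli_sum_pmf n x) + v * tsallis_entropy q n (bernoulli_sum_pmf n y)
      \<le> tsallis_entropy q n (bernoulli_sum_pmf n (u *\<^sub>R x + v *\<^sub>R y))"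
    using q by (simp add: tsallis_entropy_eq)
qed

lemma tsallis_strictly_concave_on_open_unit_cube:
  assumes q: "0 < q" "q < 1"
  shows "strictly_concave_on (open_unit_cube n) (\<lambda>p. tsallis_entropy q n (bernoulli_sum_pmf n p))"
  unfolding strictly_concave_on_def
proof (intro conjI convex_open_unit_cube ballI impI allI)
  fix x y :: "nat \<Rightarrow>\<^sub>0 real" and u v :: real
  assume a: "x \<in> open_unit_cube n" "y \<in> open_unit_cube n" "x \<noteq> y" "0 < u" "0 < v" "u + v = 1"
  let ?P = "\<lambda>p. power_sum q n (bernoulli_sum_pmf n p)"
  have "u * ?P x + v * ?P y < ?P (u *\<^sub>R x + v *\<^sub>R y)"
    using power_sum_strictly_concave_on_open_unit_cube[OF q, of n] a unfolding strictly_concave_on_def by blast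
  then have "(u * ?P x + v * ?P y - (u + v)) / (1 - q) < (?P (u *\<^sub>R x + v *\<^sub>R y) - 1) / (1 - q)"
    using q a by (intro divide_strict_right_mono) auto
  also have "(u * ?P x + v * ?P y - (u + v)) / (1 - q) = u * ((?P x - 1) / (1 - q)) + v * ((?P y - 1) / (1 - q))"
    by (simp add: add_divide_distrib[symmetric] algebra_simps)
  finally show "u * tsallis_entropy q n (bernoulli_sum_pmf n x) + v * tsallis_entropy q n (bernoulli_sum_pmf n y)
      < tsallis_entropy q n (bernoulli_sum_pmf n (u *\<^sub>R x + v *\<^sub>R y))"
    using q by (simp add: tsallis_entropy_eq)
qed

lemma ln_weighted_mean_ge:
  fixes u v a b :: real
  assumes "0 \<le> u" "0 \<le> v" "u + v = 1" "0 < a" "0 < b"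
  shows "u * ln a + v * ln b \<le> ln (u * a + v * b)" and "0 < u * a + v * b"
proof -
  show "u * ln a + v * ln b \<le> ln (u * a + v * b)"
    using ln_concave assms unfolding concave_on_iff by auto
  show "0 < u * a + v * b"
    using assms by (cases "u = 0") (simp_all add: add_pos_nonneg)
qed

text \<open>For \<open>q < 1\<close> the entropy is a positive multiple of \<open>ln\<close> of a
  positive concave function, and \<open>ln\<close> is increasing and concave.\<close>

lemma renyi_concave_on_unit_cube:
  assumes q: "0 < q" "q < 1"
  shows "concave_on (unit_cube n) (\<lambda>p. renyi_entropy q n (bernoulli_sum_pmf n p))"
  unfolding concave_on_iff
proof (intro conjI convex_unit_cube ballI impI allI)
  fix x y :: "nat \<Rightarrow>\<^sub>0 real" and u v :: real
  assume a: "x \<in> unit_cube n" "y \<in> unit_cube n" "0 \<le> u" "0 \<le> v" "u + v = 1"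
  let ?P = "\<lambda>p. power_sum q n (bernoulli_sum_pmf n p)"
  have P: "u * ?P x + v * ?P y \<le> ?P (u *\<^sub>R x + v *\<^sub>R y)"
    using power_sum_concave_on_unit_cube[OF q, of n] a unfolding concave_on_iff by blast
  note mean = ln_weighted_mean_ge[OF a(3-5) power_sum_pos[OF a(1), of q] power_sum_pos[OF a(2), of q]]
  have "u * ln (?P x) + v * ln (?P y) \<le> ln (?P (u *\<^sub>R x + v *\<^sub>R y))"
    using mean(1) ln_mono[OF P mean(2)] by linarith
  then have "(u * ln (?P x) + v * ln (?P y)) / (1 - q) \<le> ln (?P (u *\<^sub>R x + v *\<^sub>R y)) / (1 - q)"
    using q by (intro divide_right_mono) auto
  then show "u * renyi_entropy q n (bernoulli_sum_pmf n x) + v * renyi_entropy q n (bernoulli_sum_pmf n y)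
      \<le> renyi_entropy q n (bernoulli_sum_pmf n (u *\<^sub>R x + v *\<^sub>R y))"
    using q by (simp add: renyi_entropy_def add_divide_distrib)
qed

lemma renyi_strictly_concave_on_open_unit_cube:
  assumes q: "0 < q" "q < 1"
  shows "strictly_concave_on (open_unit_cube n) (\<lambda>p. renyi_entropy q n (bernoulli_sum_pmf n p))"
  unfolding strictly_concave_on_def
proof (intro conjI convex_open_unit_cube ballI impI allI)
  fix x y :: "nat \<Rightarrow>\<^sub>0 real" and u v :: real
  assume a: "x \<in> open_unit_cube n" "y \<in> open_unit_cube n" "x \<noteq> y" "0 < u" "0 < v" "u + v = 1"
  let ?P = "\<lambda>p. power_sum q n (bernoulli_sum_pmf n p)"
  have P: "u * ?P x + v * ?P y < ?P (u *\<^sub>R x + v *\<^sub>R y)"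
    using power_sum_strictly_concave_on_open_unit_cube[OF q, of n] a unfolding strictly_concave_on_def by blast
  have "x \<in> unit_cube n" "y \<in> unit_cube n" using a open_unit_cube_subset by auto
  note pos = this[THEN power_sum_pos, of q]
  note mean = ln_weighted_mean_ge[OF less_imp_le[OF a(4)] less_imp_le[OF a(5)] a(6) pos]
  \<comment> \<open>Strictness is inherited from the power sum through strict monotonicity of
    \<open>ln\<close>.\<close>
  have "u * ln (?P x) + v * ln (?P y) < ln (?P (u *\<^sub>R x + v *\<^sub>R y))"
    using mean P by (intro le_less_trans[OF mean(1)]) simp
  then have "(u * ln (?P x) + v * ln (?P y)) / (1 - q) < ln (?P (u *\<^sub>R x + v *\<^sub>R y)) / (1 - q)"
    using q by (intro divide_strict_right_mono) auto
  then show "u * renyi_entropy q n (bernoulli_sum_pmf n x) + v * renyi_entropy q n (bernoulli_sum_pmf n y)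
      < renyi_entropy q n (bernoulli_sum_pmf n (u *\<^sub>R x + v *\<^sub>R y))"
    using q by (simp add: renyi_entropy_def add_divide_distrib)
qed

lemma set_pmf_bernoulli_sum_pmf: "set_pmf (bernoulli_sum_pmf n p) \<subseteq> {0..n}"
proof -
  have "(\<Sum>i = 1..n. of_bool (b i)) \<le> n" for b :: "nat \<Rightarrow> bool"
    using sum_bounded_above[of "{1..n}" "\<lambda>i. of_bool (b i) :: nat" 1] by simp
  then show ?thesis by (auto simp: bernoulli_sum_pmf_def simp del: sum_of_bool_eq)
qed

text \<open>The Shannon case is the limit \<open>q \<rightarrow> 1\<close> from below of the Tsallis case.\<close>

lemma shannon_concave_on_unit_cube:
  "concave_on (unit_cube n) (\<lambda>p. shannon_entropy n (bernoulli_sum_pmf n p))"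
  unfolding concave_on_iff
proof (intro conjI convex_unit_cube ballI impI allI)
  fix x y :: "nat \<Rightarrow>\<^sub>0 real" and u v :: real
  assume a: "x \<in> unit_cube n" "y \<in> unit_cube n" "0 \<le> u" "0 \<le> v" "u + v = 1"
  let ?T = "\<lambda>q p. tsallis_entropy q n (bernoulli_sum_pmf n p)"
  have lim: "((\<lambda>q. ?T q p) \<longlongrightarrow> shannon_entropy n (bernoulli_sum_pmf n p)) (at_left 1)" for p
    by (rule tendsto_within_subset[OF tendsto_tsallis_entropy[OF set_pmf_bernoulli_sum_pmf]]) simp
  show "u * shannon_entropy n (bernoulli_sum_pmf n x) + v * shannon_entropy n (bernoulli_sum_pmf n y)
      \<le> shannon_entropy n (bernoulli_sum_pmf n (u *\<^sub>R x + v *\<^sub>R y))"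
  proof (rule tendsto_le[OF _ lim])
    show "((\<lambda>q. u * ?T q x + v * ?T q y) \<longlongrightarrow>
        u * shannon_entropy n (bernoulli_sum_pmf n x) + v * shannon_entropy n (bernoulli_sum_pmf n y)) (at_left 1)"
      by (intro tendsto_intros lim)
    have "\<forall>\<^sub>F q in at_left (1::real). 0 < q \<and> q < 1"
      using eventually_at_left_real[OF zero_less_one] by (auto elim: eventually_mono)
    then show "\<forall>\<^sub>F q in at_left 1. u * ?T q x + v * ?T q y \<le> ?T q (u *\<^sub>R x + v *\<^sub>R y)"
      by eventually_elim (use tsallis_concave_on_unit_cube[of _ n] a in \<open>auto simp: concave_on_iff\<close>)
  qed simp
qed

subsection \<open>Failure for orders above one\<close>

lemma power_sum_bernoulli_sum_pmf_2:
  assumes "p \<in> unit_cube 2" "Poly_Mapping.lookup p 1 = x" "Poly_Mapping.lookup p 2 = y"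
  shows "power_sum q 2 (bernoulli_sum_pmf 2 p) =
    ((1 - x) * (1 - y)) powr q + (x * (1 - y) + y * (1 - x)) powr q + (x * y) powr q"
proof -
  have "{1..2} = {1, 2::nat}" by auto
  then have "bernoulli_sum_mass 2 p 0 = (1 - x) * (1 - y)"
    "bernoulli_sum_mass 2 p 1 = x * (1 - y) + y * (1 - x)" "bernoulli_sum_mass 2 p 2 = x * y"
    using assms(2,3) by (simp_all add: bernoulli_sum_mass_def wesym_insert wesym_def numeral_2_eq_2)
  moreover have "{..2} = {0, 1, 2::nat}" by auto
  ultimately show ?thesis by (simp add: power_sum_bernoulli_sum_pmf[OF assms(1)])
qed

text \<open>Midpoint concavity makes 0 a maximum of
  \<open>F (a + t *\<^sub>R b) + F (a + (- t) *\<^sub>R b)\<close>, whose second derivative at 0 is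
  \<open>D + D\<close>.\<close>

lemma second_derivative_of_concave_along_line:
  assumes conc: "concave_on S F" and S: "\<And>t. \<bar>t\<bar> < \<epsilon> \<Longrightarrow> a + t *\<^sub>R b \<in> S" and "0 < \<epsilon>"
    and D: "has_second_real_derivative (\<lambda>t. F (a + t *\<^sub>R b)) D 0"
  shows "D \<le> 0"
proof -
  let ?f = "\<lambda>t. F (a + t *\<^sub>R b)"
  obtain f' where f': "\<forall>\<^sub>F t in nhds 0. (?f has_real_derivative f' t) (at t)"
    and f'': "(f' has_real_derivative D) (at 0)"
    using D by (auto simp: has_second_real_derivative_def)
  have "filterlim (\<lambda>t::real. - t) (nhds 0) (nhds 0)"
    using tendsto_minus[OF filterlim_ident, of 0] by simp
  then have f'm: "\<forall>\<^sub>F t in nhds 0. (?f has_real_derivative f' (- t)) (at (- t))"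
    using f' by (rule eventually_compose_filterlim[rotated])
  have "D + D \<le> 0"
  proof (rule second_derivative_local_max)
    show "\<forall>\<^sub>F t in nhds 0. ((\<lambda>t. ?f t + ?f (- t)) has_real_derivative f' t + - f' (- t)) (at t)"
      using f' f'm by eventually_elim (rule DERIV_add, assumption, simp add: DERIV_mirror)
    have "((\<lambda>t. f' (- t)) has_real_derivative - D) (at 0)"
      using f'' DERIV_mirror[where f = f' and x = 0 and y = D] by simp
    then show "((\<lambda>t. f' t + - f' (- t)) has_real_derivative D + D) (at 0)"
      using DERIV_add[OF f'' DERIV_minus] by fastforce
    have "\<forall>\<^sub>F t in nhds 0. \<bar>t\<bar> < \<epsilon>"
      using \<open>0 < \<epsilon>\<close> by (auto simp: eventually_nhds_metric)
    then show "\<forall>\<^sub>F t in nhds 0. ?f t + ?f (- t) \<le> ?f 0 + ?f (- 0)"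
    proof eventually_elim
      case (elim t)
      have "(1 / 2) *\<^sub>R (a + t *\<^sub>R b) + (1 / 2) *\<^sub>R (a + (- t) *\<^sub>R b) = a"
        by (simp add: scaleR_add_right[symmetric] scaleR_half_double del: scaleR_add_right)
      moreover have "1 / 2 * ?f t + 1 / 2 * ?f (- t) \<le> F ((1 / 2) *\<^sub>R (a + t *\<^sub>R b) + (1 / 2) *\<^sub>R (a + (- t) *\<^sub>R b))"
        by (rule conc[unfolded concave_on_iff, THEN conjunct2, rule_format]) (use S[of t] S[of "- t"] elim in simp_all)
      ultimately show ?case by simp
    qed
  qed
  then show ?thesis by simp
qed

text \<open>
  Along \<open>(\<epsilon> + t, \<epsilon> - t)\<close> the masses have first derivative \<open>0\<close> and second derivative \<open>(-2, 4, -2)\<close> at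
  \<open>t = 0\<close>; \<open>\<epsilon>\<close> is chosen such that \<open>4 P(S = 1) powr (q - 1) = P(S = 0) powr (q - 1)\<close>.
\<close>

lemma entropies_convex_along_line:
  fixes q :: real
  assumes q: "1 < q"
  obtains a b :: "nat \<Rightarrow>\<^sub>0 real" and \<epsilon> D1 D2 :: real
  where "0 < \<epsilon>" "\<And>t. \<bar>t\<bar> < \<epsilon> \<Longrightarrow> a + t *\<^sub>R b \<in> open_unit_cube 2" "0 < D1" "0 < D2"
    "has_second_real_derivative (\<lambda>t. renyi_entropy q 2 (bernoulli_sum_pmf 2 (a + t *\<^sub>R b))) D1 0"
    "has_second_real_derivative (\<lambda>t. tsallis_entropy q 2 (bernoulli_sum_pmf 2 (a + t *\<^sub>R b))) D2 0"
proof -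
  \<comment> \<open>\<open>\<delta>\<close> solves \<open>4 * \<delta> powr (q - 1) = 1\<close> and
    \<open>\<epsilon>\<close> solves \<open>2 * \<epsilon> = \<delta> * (1 - \<epsilon>)\<close>.
    Hence at \<open>t = 0\<close> the mass \<open>2 * \<epsilon> * (1 - \<epsilon>)\<close> at 1 is
    \<open>\<delta>\<close> times the mass \<open>(1 - \<epsilon>)\<^sup>2\<close> at 0.\<close>
  define \<delta> where "\<delta> = (1 / 4) powr (1 / (q - 1))"
  define \<epsilon> where "\<epsilon> = \<delta> / (2 + \<delta>)"
  have \<delta>: "0 < \<delta>" "\<delta> < 1"
    using q powr_less_mono2[of "1 / (q - 1)" "1 / 4" 1] by (simp_all add: \<delta>_def)
  have \<epsilon>: "0 < \<epsilon>" "\<epsilon> < 1 / 2" "2 * \<epsilon> = \<delta> * (1 - \<epsilon>)"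
    using \<delta> by (simp_all add: \<epsilon>_def field_simps)
  define a b :: "nat \<Rightarrow>\<^sub>0 real" where "a = Poly_Mapping.single 1 \<epsilon> + Poly_Mapping.single 2 \<epsilon>"
    and "b = Poly_Mapping.single 1 1 - Poly_Mapping.single 2 1"
  have l: "Poly_Mapping.lookup (a + t *\<^sub>R b) 1 = \<epsilon> + t" "Poly_Mapping.lookup (a + t *\<^sub>R b) 2 = \<epsilon> - t"
    "i \<notin> {1..2} \<Longrightarrow> Poly_Mapping.lookup (a + t *\<^sub>R b) i = 0" for t i
    by (auto simp: a_def b_def lookup_add lookup_minus lookup_single when_def)
  have cube: "a + t *\<^sub>R b \<in> open_unit_cube 2" if "\<bar>t\<bar> < \<epsilon>" for t
  proof -
    have "{1..2} = {1, 2::nat}" by auto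
    then show ?thesis using l that \<epsilon> unfolding mem_open_unit_cube by (auto simp: abs_less_iff)
  qed
  define f0 f1 f2 :: "real \<Rightarrow> real" where "f0 t = (1 - \<epsilon>)\<^sup>2 - t\<^sup>2" and "f1 t = 2 * \<epsilon> * (1 - \<epsilon>) + 2 * t\<^sup>2"
    and "f2 t = \<epsilon>\<^sup>2 - t\<^sup>2" for t
  define P where "P t = f0 t powr q + f1 t powr q + f2 t powr q" for t
  \<comment> \<open>Each mass has a derivative proportional to \<open>t\<close>, so
    \<open>P' t\<close> is \<open>q * t * K t\<close>, and the second derivative of \<open>P\<close>
    at 0 is \<open>q * K 0\<close>.\<close>
  define K where "K t = 4 * f1 t powr (q - 1) - 2 * f0 t powr (q - 1) - 2 * f2 t powr (q - 1)" for t
  define P' where "P' t = q * (t * K t)" for t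
  have PS: "power_sum q 2 (bernoulli_sum_pmf 2 (a + t *\<^sub>R b)) = P t" if "\<bar>t\<bar> < \<epsilon>" for t
  proof -
    have "(1 - (\<epsilon> + t)) * (1 - (\<epsilon> - t)) = f0 t"
      "(\<epsilon> + t) * (1 - (\<epsilon> - t)) + (\<epsilon> - t) * (1 - (\<epsilon> + t)) = f1 t" "(\<epsilon> + t) * (\<epsilon> - t) = f2 t"
      by (simp_all add: f0_def f1_def f2_def power2_eq_square algebra_simps)
    then show ?thesis
      using power_sum_bernoulli_sum_pmf_2[OF subsetD[OF open_unit_cube_subset cube[OF that]] l(1,2), of q]
      by (simp add: P_def)
  qed
  have pos: "0 < f0 t" "0 < f1 t" "0 < f2 t" if "\<bar>t\<bar> < \<epsilon>" for t
  proof -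
    have "t\<^sup>2 < \<epsilon>\<^sup>2" using power_strict_mono[OF that, of 2] by simp
    moreover have "\<epsilon>\<^sup>2 < (1 - \<epsilon>)\<^sup>2" using \<epsilon> by (intro power_strict_mono) auto
    ultimately show "0 < f0 t" "0 < f2 t" by (simp_all add: f0_def f2_def)
    show "0 < f1 t" using \<epsilon> by (simp add: f1_def add_pos_nonneg)
  qed
  have d: "(f0 has_real_derivative - 2 * t) (at t)" "(f1 has_real_derivative 4 * t) (at t)"
    "(f2 has_real_derivative - 2 * t) (at t)" for t
    unfolding f0_def[abs_def] f1_def[abs_def] f2_def[abs_def] by (auto intro!: derivative_eq_intros)
  have P: "(P has_real_derivative P' t) (at t)" if "\<bar>t\<bar> < \<epsilon>" for t
    unfolding P_def[abs_def]
    by (rule DERIV_cong[OF DERIV_add[OF DERIV_add[OF DERIV_chain2[OF has_real_derivative_powr d(1)]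
            DERIV_chain2[OF has_real_derivative_powr d(2)]] DERIV_chain2[OF has_real_derivative_powr d(3)]]])
      (use pos[OF that] in \<open>auto simp: P'_def K_def algebra_simps\<close>)
  have pw: "((\<lambda>t. f t powr (q - 1)) has_real_derivative (q - 1) * f 0 powr (q - 1 - 1) * D) (at 0)"
    if "(f has_real_derivative D) (at 0)" "0 < f 0" for f D
    by (rule DERIV_chain2[OF has_real_derivative_powr[OF that(2)] that(1)])
  have pos0: "0 < f0 0" "0 < f1 0" "0 < f2 0" using pos[of 0] \<epsilon> by simp_all
  \<comment> \<open>Any value \<open>KD\<close> serves, since \<open>t * K t\<close> has derivative
    \<open>K 0\<close> at 0.\<close>
  obtain KD where KD: "(K has_real_derivative KD) (at 0)"
    by (rule that[unfolded K_def[abs_def], OF DERIV_diff[OF DERIV_diff[OF DERIV_cmult[OF pw[OF d(2) pos0(2)]]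
      DERIV_cmult[OF pw[OF d(1) pos0(1)]]] DERIV_cmult[OF pw[OF d(3) pos0(3)]]]])
  have P': "(P' has_real_derivative q * K 0) (at 0)"
    unfolding P'_def[abs_def]
    by (rule DERIV_cong[OF DERIV_cmult[OF DERIV_mult[OF DERIV_ident KD]]]) simp
  \<comment> \<open>By the choice of \<open>\<delta>\<close> the first two terms of
    \<open>K 0\<close> combine to \<open>- f0 0 powr (q - 1)\<close>. The factor
    \<open>1 / (1 - q)\<close> in both entropies reverses the sign.\<close>
  have K0: "K 0 < 0"
  proof -
    have "f1 0 = \<delta> * f0 0"
      using \<epsilon>(3) by (simp add: f1_def f0_def power2_eq_square)
    moreover have "\<delta> powr (q - 1) = 1 / 4" using q by (simp add: \<delta>_def powr_powr)
    ultimately have "4 * f1 0 powr (q - 1) = f0 0 powr (q - 1)"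
      using \<delta> pos[of 0] \<epsilon> by (simp add: powr_mult)
    moreover have "0 < f0 0 powr (q - 1)" "0 < f2 0 powr (q - 1)" using pos[of 0] \<epsilon> by simp_all
    ultimately show ?thesis unfolding K_def by linarith
  qed
  have Ppos: "0 < P t" if "\<bar>t\<bar> < \<epsilon>" for t
    using pos[OF that] by (simp add: P_def add_pos_pos)
  have near: "\<forall>\<^sub>F t in nhds 0. \<bar>t\<bar> < \<epsilon>"
    using \<epsilon> by (auto simp: eventually_nhds_metric)
  have transfer: "has_second_real_derivative f D 0"
    if eq: "\<And>t. \<bar>t\<bar> < \<epsilon> \<Longrightarrow> f t = u t" and u: "\<And>t. \<bar>t\<bar> < \<epsilon> \<Longrightarrow> (u has_real_derivative u' t) (at t)"
      and u': "(u' has_real_derivative D) (at 0)" for f u u' D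
    unfolding has_second_real_derivative_def
  proof (intro exI[of _ u'] conjI u')
    show "\<forall>\<^sub>F t in nhds 0. (f has_real_derivative u' t) (at t)"
      using near
    proof eventually_elim
      case (elim t)
      have "open {t. \<bar>t\<bar> < \<epsilon>}" by (intro open_Collect_less continuous_intros)
      then show ?case
        using elim eq by (intro has_field_derivative_transform_within_open[OF u[OF elim], of "{t. \<bar>t\<bar> < \<epsilon>}"]) auto
    qed
  qed
  have "has_second_real_derivative (\<lambda>t. tsallis_entropy q 2 (bernoulli_sum_pmf 2 (a + t *\<^sub>R b))) (q * K 0 / (1 - q)) 0"
  proof (rule transfer)
    show "tsallis_entropy q 2 (bernoulli_sum_pmf 2 (a + t *\<^sub>R b)) = (P t - 1) / (1 - q)" if "\<bar>t\<bar> < \<epsilon>" for t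
      using q by (simp add: tsallis_entropy_eq PS[OF that])
    show "((\<lambda>t. (P t - 1) / (1 - q)) has_real_derivative P' t / (1 - q)) (at t)" if "\<bar>t\<bar> < \<epsilon>" for t
      by (rule DERIV_cong[OF DERIV_cdivide[OF DERIV_diff[OF P[OF that] DERIV_const]]]) simp
    show "((\<lambda>t. P' t / (1 - q)) has_real_derivative q * K 0 / (1 - q)) (at 0)"
      by (rule DERIV_cdivide[OF P'])
  qed
  moreover have "has_second_real_derivative (\<lambda>t. renyi_entropy q 2 (bernoulli_sum_pmf 2 (a + t *\<^sub>R b)))
      (1 / (1 - q) * (q * K 0 / P 0)) 0"
  proof (rule transfer)
    show "renyi_entropy q 2 (bernoulli_sum_pmf 2 (a + t *\<^sub>R b)) = 1 / (1 - q) * ln (P t)" if "\<bar>t\<bar> < \<epsilon>" for t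
      using q by (simp add: renyi_entropy_def PS[OF that])
    show "((\<lambda>t. 1 / (1 - q) * ln (P t)) has_real_derivative 1 / (1 - q) * (P' t / P t)) (at t)" if "\<bar>t\<bar> < \<epsilon>" for t
      by (rule DERIV_cong[OF DERIV_cmult[OF DERIV_chain2[OF DERIV_ln_divide[OF Ppos[OF that]] P[OF that]]]]) simp
    \<comment> \<open>The quotient rule keeps only its first term because
      \<open>P' 0 = 0\<close>.\<close>
    show "((\<lambda>t. 1 / (1 - q) * (P' t / P t)) has_real_derivative 1 / (1 - q) * (q * K 0 / P 0)) (at 0)"
      by (rule DERIV_cong[OF DERIV_cmult[OF DERIV_divide[OF P' P]]])
        (use \<epsilon> Ppos[of 0] in \<open>auto simp: P'_def power2_eq_square\<close>)
  qed
  moreover have "0 < q * K 0 / (1 - q)"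
    using q K0 by (intro divide_neg_neg mult_pos_neg) auto
  moreover have "0 < 1 / (1 - q) * (q * K 0 / P 0)"
    using q K0 Ppos[of 0] \<epsilon> by (intro mult_neg_neg divide_pos_neg divide_neg_pos mult_pos_neg) auto
  ultimately show ?thesis using that[OF \<epsilon>(1) cube] by blast
qed

lemma not_concave_entropies:
  assumes q: "1 < q"
  shows "\<not> concave_on (unit_cube 2) (\<lambda>p. renyi_entropy q 2 (bernoulli_sum_pmf 2 p))"
    and "\<not> concave_on (unit_cube 2) (\<lambda>p. tsallis_entropy q 2 (bernoulli_sum_pmf 2 p))"
proof -
  obtain a b :: "nat \<Rightarrow>\<^sub>0 real" and \<epsilon> D1 D2 :: real
    where \<epsilon>: "0 < \<epsilon>" and cube: "\<And>t. \<bar>t\<bar> < \<epsilon> \<Longrightarrow> a + t *\<^sub>R b \<in> open_unit_cube 2" and D: "0 < D1" "0 < D2"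
      and R: "has_second_real_derivative (\<lambda>t. renyi_entropy q 2 (bernoulli_sum_pmf 2 (a + t *\<^sub>R b))) D1 0"
      and T: "has_second_real_derivative (\<lambda>t. tsallis_entropy q 2 (bernoulli_sum_pmf 2 (a + t *\<^sub>R b))) D2 0"
    by (rule entropies_convex_along_line[OF q]) blast
  have S: "a + t *\<^sub>R b \<in> unit_cube 2" if "\<bar>t\<bar> < \<epsilon>" for t
    using cube[OF that] open_unit_cube_subset by auto
  show "\<not> concave_on (unit_cube 2) (\<lambda>p. renyi_entropy q 2 (bernoulli_sum_pmf 2 p))"
    using second_derivative_of_concave_along_line[OF _ S \<epsilon> R] D by auto
  show "\<not> concave_on (unit_cube 2) (\<lambda>p. tsallis_entropy q 2 (bernoulli_sum_pmf 2 p))"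
    using second_derivative_of_concave_along_line[OF _ S \<epsilon> T] D by auto
qed

theorem theorem1p1:
  fixes q :: real
  assumes "q > 0"
  shows
    "(q < 1 \<longrightarrow> (\<forall>n\<ge>1.
        concave_on (unit_cube n) (\<lambda>p. power_sum q n (bernoulli_sum_pmf n p)) \<and>
        strictly_concave_on (open_unit_cube n) (\<lambda>p. power_sum q n (bernoulli_sum_pmf n p)) \<and>
        concave_on (unit_cube n) (\<lambda>p. renyi_entropy q n (bernoulli_sum_pmf n p)) \<and>
        strictly_concave_on (open_unit_cube n) (\<lambda>p. renyi_entropy q n (bernoulli_sum_pmf n p)) \<and>
        concave_on (unit_cube n) (\<lambda>p. tsallis_entropy q n (bernoulli_sum_pmf n p)) \<and>
        strictly_concave_on (open_unit_cube n) (\<lambda>p. tsallis_entropy q n (bernoulli_sum_pmf n p)))) \<and>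
     (q = 1 \<longrightarrow> (\<forall>n\<ge>1.
        (\<forall>p\<in>unit_cube n.
           renyi_entropy q n (bernoulli_sum_pmf n p) = shannon_entropy n (bernoulli_sum_pmf n p) \<and>
           tsallis_entropy q n (bernoulli_sum_pmf n p) = shannon_entropy n (bernoulli_sum_pmf n p)) \<and>
        concave_on (unit_cube n) (\<lambda>p. shannon_entropy n (bernoulli_sum_pmf n p)))) \<and>
     (q > 1 \<longrightarrow>
        \<not> concave_on (unit_cube 2) (\<lambda>p. renyi_entropy q 2 (bernoulli_sum_pmf 2 p)) \<and>
        \<not> concave_on (unit_cube 2) (\<lambda>p. tsallis_entropy q 2 (bernoulli_sum_pmf 2 p)) \<and>
        (\<exists>a b :: nat \<Rightarrow>\<^sub>0 real. \<exists>\<epsilon>>0.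
           (\<forall>t\<in>{-\<epsilon><..<\<epsilon>}. a + t *\<^sub>R b \<in> open_unit_cube 2) \<and>
           (\<exists>D>0. has_second_real_derivative
              (\<lambda>t. renyi_entropy q 2 (bernoulli_sum_pmf 2 (a + t *\<^sub>R b))) D 0) \<and>
           (\<exists>D>0. has_second_real_derivative
              (\<lambda>t. tsallis_entropy q 2 (bernoulli_sum_pmf 2 (a + t *\<^sub>R b))) D 0))) \<and>
     ((\<forall>n\<ge>1. concave_on (unit_cube n) (\<lambda>p. renyi_entropy q n (bernoulli_sum_pmf n p))) \<longleftrightarrow> q \<le> 1) \<and>
     ((\<forall>n\<ge>1. concave_on (unit_cube n) (\<lambda>p. tsallis_entropy q n (bernoulli_sum_pmf n p))) \<longleftrightarrow> q \<le> 1)"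
proof -
  have lt: "concave_on (unit_cube n) (\<lambda>p. power_sum q n (bernoulli_sum_pmf n p)) \<and>
      strictly_concave_on (open_unit_cube n) (\<lambda>p. power_sum q n (bernoulli_sum_pmf n p)) \<and>
      concave_on (unit_cube n) (\<lambda>p. renyi_entropy q n (bernoulli_sum_pmf n p)) \<and>
      strictly_concave_on (open_unit_cube n) (\<lambda>p. renyi_entropy q n (bernoulli_sum_pmf n p)) \<and>
      concave_on (unit_cube n) (\<lambda>p. tsallis_entropy q n (bernoulli_sum_pmf n p)) \<and>
      strictly_concave_on (open_unit_cube n) (\<lambda>p. tsallis_entropy q n (bernoulli_sum_pmf n p))"
    if "q < 1" for n
    using assms that
    by (intro conjI power_sum_concave_on_unit_cube power_sum_strictly_concave_on_open_unit_cube
        renyi_concave_on_unit_cube renyi_strictly_concave_on_open_unit_cube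
        tsallis_concave_on_unit_cube tsallis_strictly_concave_on_open_unit_cube)
  have eq: "renyi_entropy q n P = shannon_entropy n P" "tsallis_entropy q n P = shannon_entropy n P"
    if "q = 1" for n P
    using that by (simp_all add: renyi_entropy_def tsallis_entropy_def)
  have gt: "\<exists>a b :: nat \<Rightarrow>\<^sub>0 real. \<exists>\<epsilon>>0.
      (\<forall>t\<in>{-\<epsilon><..<\<epsilon>}. a + t *\<^sub>R b \<in> open_unit_cube 2) \<and>
      (\<exists>D>0. has_second_real_derivative
        (\<lambda>t. renyi_entropy q 2 (bernoulli_sum_pmf 2 (a + t *\<^sub>R b))) D 0) \<and>
      (\<exists>D>0. has_second_real_derivative
        (\<lambda>t. tsallis_entropy q 2 (bernoulli_sum_pmf 2 (a + t *\<^sub>R b))) D 0)" if q1: "1 < q"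
  proof -
    obtain a b :: "nat \<Rightarrow>\<^sub>0 real" and \<epsilon> D1 D2 :: real
      where *: "0 < \<epsilon>" "\<And>t. \<bar>t\<bar> < \<epsilon> \<Longrightarrow> a + t *\<^sub>R b \<in> open_unit_cube 2" "0 < D1" "0 < D2"
        "has_second_real_derivative (\<lambda>t. renyi_entropy q 2 (bernoulli_sum_pmf 2 (a + t *\<^sub>R b))) D1 0"
        "has_second_real_derivative (\<lambda>t. tsallis_entropy q 2 (bernoulli_sum_pmf 2 (a + t *\<^sub>R b))) D2 0"
      by (rule entropies_convex_along_line[OF q1]) blast
    have "\<forall>t\<in>{-\<epsilon><..<\<epsilon>}. a + t *\<^sub>R b \<in> open_unit_cube 2"
      using *(2) by (auto simp: abs_less_iff)
    with * show ?thesis by blast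
  qed
  have R: "(\<forall>n\<ge>1. concave_on (unit_cube n) (\<lambda>p. renyi_entropy q n (bernoulli_sum_pmf n p))) \<longleftrightarrow> q \<le> 1"
  proof (cases q "1::real" rule: linorder_cases)
    case greater
    then show ?thesis using not_concave_entropies(1) by (auto intro!: exI[of _ 2])
  qed (use lt eq shannon_concave_on_unit_cube in simp_all)
  have T: "(\<forall>n\<ge>1. concave_on (unit_cube n) (\<lambda>p. tsallis_entropy q n (bernoulli_sum_pmf n p))) \<longleftrightarrow> q \<le> 1"
  proof (cases q "1::real" rule: linorder_cases)
    case greater
    then show ?thesis using not_concave_entropies(2) by (auto intro!: exI[of _ 2])
  qed (use lt eq shannon_concave_on_unit_cube in simp_all)
  show ?thesis
    using lt eq shannon_concave_on_unit_cube not_concave_entropies gt R T by (intro conjI impI allI ballI) simp_all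
qed

end
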